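(* Let $Y=(Y_1,Y_2)\in\mathcal{L}^2(\Omega,\mathcal{F},\mathbb{P})$ and suppose $\nu=\operatorname{Law}(Y)$ is atomless. Then $$\min_{\gamma\in\Gamma(\nu)}\int c(x,y)\,d\gamma=\inf_{X\in\mathcal{X}(Y)}\mathbb{E}[c(X,Y)].$$
   Context: $c(x,y)=(x_1-y_1)(x_2-y_2)$ for $x,y\in\mathbb{R}^2$. $\Gamma(\nu)$ is the set of Borel probability measures $\gamma$ on $\mathbb{R}^2\times\mathbb{R}^2$ (points $(x,y)$) with finite second moment, $y$-marginal $\nu$, and $\gamma(y|x)=x$ (the conditional expectation of $y$ given $x$ under $\gamma$ equals $x$, $\gamma$-a.s.); the minimum on the left is attained. $\mathcal{X}(Y)$ is the set of two-dimensional random variables $X=(X_1,X_2)\in\mathcal{L}^2$ that are $Y$-measurable and satisfy $\mathbb{E}[Y|X]=X$. *)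

theory Defs
  imports "HOL-Probability.Probability"
begin

definition cost :: "real \<times> real \<Rightarrow> real \<times> real \<Rightarrow> real" where
  "cost x y = (fst x - fst y) * (snd x - snd y)"

definition cond_exp_given_eq :: "'a measure \<Rightarrow> ('a \<Rightarrow> real \<times> real) \<Rightarrow> ('a \<Rightarrow> real \<times> real) \<Rightarrow> bool" where
  "cond_exp_given_eq M V W \<longleftrightarrow>
     (AE \<omega> in M. real_cond_exp M (vimage_algebra (space M) W borel) (\<lambda>\<omega>. fst (V \<omega>)) \<omega> = fst (W \<omega>)) \<and>
     (AE \<omega> in M. real_cond_exp M (vimage_algebra (space M) W borel) (\<lambda>\<omega>. snd (V \<omega>)) \<omega> = snd (W \<omega>))"

definition Gamma :: "(real \<times> real) measure \<Rightarrow> ((real \<times> real) \<times> (real \<times> real)) measure set" where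
  "Gamma \<nu> = {\<gamma>. prob_space \<gamma> \<and> sets \<gamma> = sets borel \<and>
      integrable \<gamma> (\<lambda>z. (norm z)\<^sup>2) \<and>
      distr \<gamma> borel snd = \<nu> \<and>
      cond_exp_given_eq \<gamma> snd fst}"

definition Xset :: "'a measure \<Rightarrow> ('a \<Rightarrow> real \<times> real) \<Rightarrow> ('a \<Rightarrow> real \<times> real) set" where
  "Xset M Y = {X. X \<in> measurable (vimage_algebra (space M) Y borel) borel \<and>
      integrable M (\<lambda>\<omega>. (norm (X \<omega>))\<^sup>2) \<and>
      cond_exp_given_eq M Y X}"

end

theory Submission
  imports Defs "HOL-Real_Asymp.Real_Asymp"
begin

text \<open>
  On \<open>Gamma\<close> the cost is \<open>E[y\<^sub>1 y\<^sub>2] - E[x\<^sub>1 x\<^sub>2]\<close>, because \<open>x\<close> is the conditional mean of \<open>y\<close>.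

  A minimiser exists by sequential compactness. Plans on the 4-dimensional space are coded as laws on
  the real line by a Borel section of a Schoenberg space-filling curve, so that Helly's selection
  theorem and Skorohod's representation give almost surely convergent random variables
  \<open>(X\<^sub>n, Y\<^sub>n)\<close> along a subsequence. The \<open>Y\<^sub>n\<close> have a fixed law and hence converge in L2, the
  \<open>X\<^sub>n\<close> are bounded in L2, and this suffices to pass to the limit in the martingale condition
  and in \<open>E[x\<^sub>1 x\<^sub>2] = E[x\<^sub>1 y\<^sub>2]\<close>.

  For the infimum over maps, \<open>x\<close> is first replaced by its conditional mean given a finite label. An
  atomless law of \<open>y\<close> can be cut into pieces of prescribed mass, so the label is imitated by a
  function of \<open>y\<close> with almost the same masses and barycentres.
\<close>

section \<open>Square-integrable functions\<close>

text \<open>The product x1 x2 is quadratic, so a second moment bound alone does not make its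
  expectation continuous under almost sure convergence. Testing the martingale condition with x1
  trades it for x1 y2, where one factor converges strongly because its law never changes. The coding
  of plans need not be continuous: only the decoding must be, and only along sequences that do not
  escape to infinity. Being injective, the coding also carries an atomless law on the plane to a law
  on the line with continuous distribution function, from which pieces of prescribed mass are cut by
  the intermediate value theorem. Matching the masses of the label says nothing about barycentres.
  The label is therefore imitated jointly with a finite discretisation of y: its masses are then
  reproduced exactly, and its unnormalised barycentres up to twice the L1 error of the
  discretisation. The map finally used is the conditional mean of y given the imitating label, so it
  satisfies the martingale condition exactly and only the cost is approximate.\<close>

lemma borel_measurable_components [measurable (raw)]:
  fixes X :: "'a \<Rightarrow> 'b::second_countable_topology \<times> 'c::second_countable_topology"
  assumes "X \<in> borel_measurable M"
  shows "(\<lambda>x. fst (X x)) \<in> borel_measurable M" "(\<lambda>x. snd (X x)) \<in> borel_measurable M"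
  using assms unfolding borel_prod[symmetric] by simp_all

lemma borel_measurable_fst_snd [measurable]:
  "(fst :: 'b::second_countable_topology \<times> 'c::second_countable_topology \<Rightarrow> 'b) \<in> borel_measurable borel"
  "(snd :: 'b::second_countable_topology \<times> 'c::second_countable_topology \<Rightarrow> 'c) \<in> borel_measurable borel"
  using borel_measurable_components[of "\<lambda>x. x"] by auto

lemma abs_component_le_norm:
  fixes p :: "real \<times> real"
  shows "\<bar>fst p\<bar> \<le> norm p" "\<bar>snd p\<bar> \<le> norm p"
  using norm_fst_le[of "fst p" "snd p"] norm_snd_le[of "snd p" "fst p"] by auto

lemma square_integrable_mult:
  fixes f g :: "'a \<Rightarrow> real"
  assumes [measurable]: "f \<in> borel_measurable M" "g \<in> borel_measurable M"
    and "integrable M (\<lambda>x. (f x)\<^sup>2)" "integrable M (\<lambda>x. (g x)\<^sup>2)"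
  shows "integrable M (\<lambda>x. f x * g x)"
proof (rule Bochner_Integration.integrable_bound)
  show "integrable M (\<lambda>x. (f x)\<^sup>2 + (g x)\<^sup>2)" using assms by simp
  show "AE x in M. norm (f x * g x) \<le> norm ((f x)\<^sup>2 + (g x)\<^sup>2)"
  proof (intro AE_I2)
    fix x
    have "2 * \<bar>f x * g x\<bar> \<le> (f x)\<^sup>2 + (g x)\<^sup>2"
      using zero_le_power2[of "\<bar>f x\<bar> - \<bar>g x\<bar>"] by (simp add: power2_diff abs_mult)
    then show "norm (f x * g x) \<le> norm ((f x)\<^sup>2 + (g x)\<^sup>2)" by simp
  qed
qed measurable

lemma square_integrable_diff:
  fixes f g :: "'a \<Rightarrow> real"
  assumes [measurable]: "f \<in> borel_measurable M" "g \<in> borel_measurable M"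
    and "integrable M (\<lambda>x. (f x)\<^sup>2)" "integrable M (\<lambda>x. (g x)\<^sup>2)"
  shows "integrable M (\<lambda>x. (f x - g x)\<^sup>2)"
  using assms square_integrable_mult[OF assms] by (simp add: power2_diff mult.assoc)

text \<open>Discriminant argument for the quadratic \<open>s\<^sup>2 * a - 2 * s * c + b\<close>,
  which is nonnegative as the integral of a square. For a > 0 the optimal choice is s = c / a; for a
  = 0, dividing by s and letting s tend to infinity forces c = 0.\<close>

lemma Cauchy_Schwarz_abs_integral:
  fixes f g :: "'a \<Rightarrow> real"
  assumes [measurable]: "f \<in> borel_measurable M" "g \<in> borel_measurable M"
    and f: "integrable M (\<lambda>x. (f x)\<^sup>2)" and g: "integrable M (\<lambda>x. (g x)\<^sup>2)"
  shows "(\<integral>x. \<bar>f x * g x\<bar> \<partial>M) \<le> sqrt (\<integral>x. (f x)\<^sup>2 \<partial>M) * sqrt (\<integral>x. (g x)\<^sup>2 \<partial>M)"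
proof -
  define a where "a = (\<integral>x. (f x)\<^sup>2 \<partial>M)"
  define b where "b = (\<integral>x. (g x)\<^sup>2 \<partial>M)"
  define c where "c = (\<integral>x. \<bar>f x * g x\<bar> \<partial>M)"
  have fg: "integrable M (\<lambda>x. \<bar>f x * g x\<bar>)" using square_integrable_mult[OF assms] by simp
  have ab: "0 \<le> a" "0 \<le> b" "0 \<le> c" unfolding a_def b_def c_def by auto
  have quad: "2 * s * c \<le> s\<^sup>2 * a + b" for s
  proof -
    have "0 \<le> (\<integral>x. (s * \<bar>f x\<bar> - \<bar>g x\<bar>)\<^sup>2 \<partial>M)" by simp
    also have "\<dots> = (\<integral>x. s\<^sup>2 * (f x)\<^sup>2 - 2 * s * \<bar>f x * g x\<bar> + (g x)\<^sup>2 \<partial>M)"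
      by (intro Bochner_Integration.integral_cong) (auto simp: power2_diff power_mult_distrib abs_mult)
    also have "\<dots> = s\<^sup>2 * a - 2 * s * c + b" unfolding a_def b_def c_def using f g fg by simp
    finally show ?thesis by simp
  qed
  have "c\<^sup>2 \<le> a * b"
  proof (cases "a = 0")
    case True
    then have "c \<le> b / (2 * s)" if "s > 0" for s using quad[of s] that by (simp add: field_simps)
    moreover have "((\<lambda>s. b / (2 * s)) \<longlongrightarrow> 0) at_top" by real_asymp
    ultimately have "c \<le> 0"
      by (intro tendsto_lowerbound[of _ _ at_top]) (auto intro: eventually_mono[OF eventually_gt_at_top[of 0]])
    then show ?thesis using ab True by simp
  next
    case False
    then show ?thesis using quad[of "c / a"] ab
      by (simp add: field_simps power2_eq_square)
  qed
  then have "c \<le> sqrt (a * b)" using ab by (simp add: real_le_rsqrt)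
  then show ?thesis unfolding a_def b_def c_def by (simp add: real_sqrt_mult)
qed

text \<open>Fatou's lemma: a uniform bound on second moments survives an almost sure limit, although
  the second moments themselves need not converge.\<close>

lemma square_integrable_AE_limit:
  fixes u :: "nat \<Rightarrow> 'a \<Rightarrow> real"
  assumes [measurable]: "\<And>n. u n \<in> borel_measurable M" "v \<in> borel_measurable M"
    and int: "\<And>n. integrable M (\<lambda>x. (u n x)\<^sup>2)"
    and bd: "\<And>n. (\<integral>x. (u n x)\<^sup>2 \<partial>M) \<le> C"
    and lim: "AE x in M. (\<lambda>n. u n x) \<longlonglongrightarrow> v x"
  shows "integrable M (\<lambda>x. (v x)\<^sup>2)" "(\<integral>x. (v x)\<^sup>2 \<partial>M) \<le> C"
proof -
  have "0 \<le> (\<integral>x. (u 0 x)\<^sup>2 \<partial>M)" by simp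
  with bd[of 0] have C: "0 \<le> C" by linarith
  have "(\<integral>\<^sup>+ x. ennreal ((v x)\<^sup>2) \<partial>M) = (\<integral>\<^sup>+ x. liminf (\<lambda>n. ennreal ((u n x)\<^sup>2)) \<partial>M)"
  proof (rule nn_integral_cong_AE, use lim in eventually_elim)
    fix x assume "(\<lambda>n. u n x) \<longlonglongrightarrow> v x"
    then have "(\<lambda>n. ennreal ((u n x)\<^sup>2)) \<longlonglongrightarrow> ennreal ((v x)\<^sup>2)" by (intro tendsto_intros)
    then show "ennreal ((v x)\<^sup>2) = liminf (\<lambda>n. ennreal ((u n x)\<^sup>2))"
      by (intro lim_imp_Liminf[symmetric]) auto
  qed
  also have "\<dots> \<le> liminf (\<lambda>n. \<integral>\<^sup>+ x. ennreal ((u n x)\<^sup>2) \<partial>M)"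
    by (rule nn_integral_liminf) measurable
  also have "\<dots> \<le> ennreal C"
    by (intro Liminf_le always_eventually allI) (auto simp: nn_integral_eq_integral int intro!: ennreal_leI bd)
  finally have *: "(\<integral>\<^sup>+ x. ennreal ((v x)\<^sup>2) \<partial>M) \<le> ennreal C" .
  then show i: "integrable M (\<lambda>x. (v x)\<^sup>2)"
    by (intro integrableI_nonneg) (auto intro: order_le_less_trans)
  show "(\<integral>x. (v x)\<^sup>2 \<partial>M) \<le> C" using * C by (simp add: nn_integral_eq_integral i)
qed

lemma L2_convergence_if_AE_and_norms:
  fixes u :: "nat \<Rightarrow> 'a \<Rightarrow> real"
  assumes [measurable]: "\<And>n. u n \<in> borel_measurable M" "v \<in> borel_measurable M"
    and int: "\<And>n. integrable M (\<lambda>x. (u n x)\<^sup>2)" "integrable M (\<lambda>x. (v x)\<^sup>2)"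
    and lim: "AE x in M. (\<lambda>n. u n x) \<longlonglongrightarrow> v x"
    and norms: "(\<lambda>n. \<integral>x. (u n x)\<^sup>2 \<partial>M) \<longlonglongrightarrow> (\<integral>x. (v x)\<^sup>2 \<partial>M)"
  shows "(\<lambda>n. \<integral>x. (u n x - v x)\<^sup>2 \<partial>M) \<longlonglongrightarrow> 0"
proof -
  text \<open>Scheffe's trick: dominated convergence only applies to \<open>min w\<^sub>n (4 v\<^sup>2)\<close>, but
    \<open>w\<^sub>n \<ge> 0\<close> and the convergence of the norms turn this into an upper bound for the distance.\<close>
  define w where "w n x = 2 * (u n x)\<^sup>2 + 2 * (v x)\<^sup>2 - (u n x - v x)\<^sup>2" for n x
  have w_eq: "w n x = (u n x + v x)\<^sup>2" for n x unfolding w_def by (simp add: power2_eq_square algebra_simps)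
  have dif: "integrable M (\<lambda>x. (u n x - v x)\<^sup>2)" for n by (intro square_integrable_diff int) measurable
  have "(\<lambda>n. \<integral>x. min (w n x) (4 * (v x)\<^sup>2) \<partial>M) \<longlonglongrightarrow> (\<integral>x. 4 * (v x)\<^sup>2 \<partial>M)"
  proof (rule integral_dominated_convergence[where w="\<lambda>x. 4 * (v x)\<^sup>2"])
    show "AE x in M. (\<lambda>n. min (w n x) (4 * (v x)\<^sup>2)) \<longlonglongrightarrow> 4 * (v x)\<^sup>2"
      using lim
    proof eventually_elim
      fix x assume "(\<lambda>n. u n x) \<longlonglongrightarrow> v x"
      then have "(\<lambda>n. min ((u n x + v x)\<^sup>2) (4 * (v x)\<^sup>2)) \<longlonglongrightarrow> min ((v x + v x)\<^sup>2) (4 * (v x)\<^sup>2)"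
        by (intro tendsto_intros)
      then show "(\<lambda>n. min (w n x) (4 * (v x)\<^sup>2)) \<longlonglongrightarrow> 4 * (v x)\<^sup>2"
        unfolding w_eq by (simp add: power_mult_distrib flip: mult_2)
    qed
    show "AE x in M. norm (min (w n x) (4 * (v x)\<^sup>2)) \<le> 4 * (v x)\<^sup>2" for n
      unfolding w_eq by (auto simp: min_def)
  qed (use int in \<open>auto simp: w_def\<close>)
  moreover have "(\<lambda>n. 2 * (\<integral>x. (u n x)\<^sup>2 \<partial>M) + 2 * (\<integral>x. (v x)\<^sup>2 \<partial>M)) \<longlonglongrightarrow> 2 * (\<integral>x. (v x)\<^sup>2 \<partial>M) + 2 * (\<integral>x. (v x)\<^sup>2 \<partial>M)"
    by (intro tendsto_intros norms)
  ultimately have "(\<lambda>n. 2 * (\<integral>x. (u n x)\<^sup>2 \<partial>M) + 2 * (\<integral>x. (v x)\<^sup>2 \<partial>M) - (\<integral>x. min (w n x) (4 * (v x)\<^sup>2) \<partial>M))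
      \<longlonglongrightarrow> 2 * (\<integral>x. (v x)\<^sup>2 \<partial>M) + 2 * (\<integral>x. (v x)\<^sup>2 \<partial>M) - (\<integral>x. 4 * (v x)\<^sup>2 \<partial>M)"
    by (intro tendsto_diff)
  then have up: "(\<lambda>n. 2 * (\<integral>x. (u n x)\<^sup>2 \<partial>M) + 2 * (\<integral>x. (v x)\<^sup>2 \<partial>M) - (\<integral>x. min (w n x) (4 * (v x)\<^sup>2) \<partial>M)) \<longlonglongrightarrow> 0"
    by simp
  show ?thesis
  proof (rule tendsto_sandwich[OF _ _ tendsto_const up])
    show "\<forall>\<^sub>F n in sequentially. (\<integral>x. (u n x - v x)\<^sup>2 \<partial>M) \<le> 2 * (\<integral>x. (u n x)\<^sup>2 \<partial>M) + 2 * (\<integral>x. (v x)\<^sup>2 \<partial>M) - (\<integral>x. min (w n x) (4 * (v x)\<^sup>2) \<partial>M)"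
    proof (intro always_eventually allI)
      fix n
      have wi: "integrable M (w n)" unfolding w_def using int dif by simp
      have "(\<integral>x. min (w n x) (4 * (v x)\<^sup>2) \<partial>M) \<le> (\<integral>x. w n x \<partial>M)"
        by (intro integral_mono Bochner_Integration.integrable_bound[OF wi] wi)
          (use int in \<open>auto simp: w_eq min_def\<close>)
      also have "\<dots> = 2 * (\<integral>x. (u n x)\<^sup>2 \<partial>M) + 2 * (\<integral>x. (v x)\<^sup>2 \<partial>M) - (\<integral>x. (u n x - v x)\<^sup>2 \<partial>M)"
        unfolding w_def using int dif by simp
      finally show "(\<integral>x. (u n x - v x)\<^sup>2 \<partial>M) \<le> 2 * (\<integral>x. (u n x)\<^sup>2 \<partial>M) + 2 * (\<integral>x. (v x)\<^sup>2 \<partial>M) - (\<integral>x. min (w n x) (4 * (v x)\<^sup>2) \<partial>M)"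
        by simp
    qed
  qed simp
qed

text \<open>The difference is cut at height 1. Below it, dominated convergence with majorant |h|
  applies. Above it, Cauchy-Schwarz pairs the bounded L2 norm of the difference with the L2 norm of
  \<open>h\<close> restricted to the set where the difference exceeds 1, and the latter norm tends
  to 0.\<close>

lemma weak_L2_convergence_if_AE_and_bounded:
  fixes u :: "nat \<Rightarrow> 'a \<Rightarrow> real"
  assumes [measurable]: "\<And>n. u n \<in> borel_measurable M" "v \<in> borel_measurable M" "h \<in> borel_measurable M"
    and int: "\<And>n. integrable M (\<lambda>x. (u n x)\<^sup>2)"
    and bd: "\<And>n. (\<integral>x. (u n x)\<^sup>2 \<partial>M) \<le> C"
    and lim: "AE x in M. (\<lambda>n. u n x) \<longlonglongrightarrow> v x"
    and h: "integrable M (\<lambda>x. (h x)\<^sup>2)" "integrable M h"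
  shows "(\<lambda>n. \<integral>x. \<bar>u n x - v x\<bar> * \<bar>h x\<bar> \<partial>M) \<longlonglongrightarrow> 0"
proof -
  note v = square_integrable_AE_limit[OF assms(1,2) int bd lim]
  have "0 \<le> (\<integral>x. (u 0 x)\<^sup>2 \<partial>M)" by simp
  with bd[of 0] have C: "0 \<le> C" by linarith
  have d: "integrable M (\<lambda>x. (u n x - v x)\<^sup>2)" for n by (intro square_integrable_diff int v) measurable
  have dbd: "(\<integral>x. (u n x - v x)\<^sup>2 \<partial>M) \<le> 4 * C" for n
  proof -
    have "(\<integral>x. (u n x - v x)\<^sup>2 \<partial>M) \<le> (\<integral>x. 2 * (u n x)\<^sup>2 + 2 * (v x)\<^sup>2 \<partial>M)"
    proof (rule integral_mono)
      fix x
      show "(u n x - v x)\<^sup>2 \<le> 2 * (u n x)\<^sup>2 + 2 * (v x)\<^sup>2"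
        using zero_le_power2[of "u n x + v x"] by (simp add: power2_sum power2_diff)
    qed (use d int v in auto)
    also have "\<dots> \<le> 4 * C" using int v bd[of n] by simp
    finally show ?thesis .
  qed
  define k where "k n x = (if \<bar>u n x - v x\<bar> > 1 then h x else 0)" for n x
  have km [measurable]: "k n \<in> borel_measurable M" for n unfolding k_def by measurable
  have lim0: "AE x in M. (\<lambda>n. \<bar>u n x - v x\<bar>) \<longlonglongrightarrow> 0"
    using lim by eventually_elim (simp add: LIM_zero tendsto_rabs_zero)
  have ki: "integrable M (\<lambda>x. (k n x)\<^sup>2)" for n
    by (rule Bochner_Integration.integrable_bound[OF h(1)]) (auto simp: k_def)
  have k0: "(\<lambda>n. \<integral>x. (k n x)\<^sup>2 \<partial>M) \<longlonglongrightarrow> (\<integral>x. 0 \<partial>M)"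
  proof (rule integral_dominated_convergence[where w="\<lambda>x. (h x)\<^sup>2"])
    show "AE x in M. (\<lambda>n. (k n x)\<^sup>2) \<longlonglongrightarrow> 0" using lim0
    proof eventually_elim
      fix x assume "(\<lambda>n. \<bar>u n x - v x\<bar>) \<longlonglongrightarrow> 0"
      then have "\<forall>\<^sub>F n in sequentially. \<bar>u n x - v x\<bar> < 1" by (rule order_tendstoD) simp
      then have "\<forall>\<^sub>F n in sequentially. (k n x)\<^sup>2 = 0" by eventually_elim (simp add: k_def)
      then show "(\<lambda>n. (k n x)\<^sup>2) \<longlonglongrightarrow> 0" by (rule tendsto_eventually)
    qed
  qed (use h in \<open>auto simp: k_def\<close>)
  have m0: "(\<lambda>n. \<integral>x. min \<bar>u n x - v x\<bar> 1 * \<bar>h x\<bar> \<partial>M) \<longlonglongrightarrow> (\<integral>x. 0 \<partial>M)"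
  proof (rule integral_dominated_convergence[where w="\<lambda>x. \<bar>h x\<bar>"])
    show "AE x in M. (\<lambda>n. min \<bar>u n x - v x\<bar> 1 * \<bar>h x\<bar>) \<longlonglongrightarrow> 0" using lim0
    proof eventually_elim
      fix x assume "(\<lambda>n. \<bar>u n x - v x\<bar>) \<longlonglongrightarrow> 0"
      then have "(\<lambda>n. min \<bar>u n x - v x\<bar> 1 * \<bar>h x\<bar>) \<longlonglongrightarrow> min 0 1 * \<bar>h x\<bar>" by (intro tendsto_intros)
      then show "(\<lambda>n. min \<bar>u n x - v x\<bar> 1 * \<bar>h x\<bar>) \<longlonglongrightarrow> 0" by simp
    qed
  qed (use h in \<open>auto simp: abs_mult intro!: mult_left_le_one_le\<close>)
  show ?thesis
  proof (rule Lim_null_comparison[OF always_eventually, OF allI])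
    fix n
    have i1: "integrable M (\<lambda>x. min \<bar>u n x - v x\<bar> 1 * \<bar>h x\<bar>)"
      by (rule Bochner_Integration.integrable_bound[OF h(2)]) (auto simp: abs_mult intro!: mult_left_le_one_le)
    have i2: "integrable M (\<lambda>x. \<bar>(u n x - v x) * k n x\<bar>)"
      by (intro integrable_abs square_integrable_mult d ki) measurable
    have i3: "integrable M (\<lambda>x. \<bar>u n x - v x\<bar> * \<bar>h x\<bar>)"
      using square_integrable_mult[OF _ _ d[of n] h(1)] by (simp flip: abs_mult)
    have "(\<integral>x. \<bar>u n x - v x\<bar> * \<bar>h x\<bar> \<partial>M) \<le> (\<integral>x. min \<bar>u n x - v x\<bar> 1 * \<bar>h x\<bar> + \<bar>(u n x - v x) * k n x\<bar> \<partial>M)"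
      by (rule integral_mono[OF i3]) (use i1 i2 in \<open>auto simp: k_def abs_mult min_def\<close>)
    also have "\<dots> = (\<integral>x. min \<bar>u n x - v x\<bar> 1 * \<bar>h x\<bar> \<partial>M) + (\<integral>x. \<bar>(u n x - v x) * k n x\<bar> \<partial>M)"
      using i1 i2 by simp
    also have "(\<integral>x. \<bar>(u n x - v x) * k n x\<bar> \<partial>M) \<le> sqrt (\<integral>x. (u n x - v x)\<^sup>2 \<partial>M) * sqrt (\<integral>x. (k n x)\<^sup>2 \<partial>M)"
      by (intro Cauchy_Schwarz_abs_integral d ki) measurable
    also have "\<dots> \<le> sqrt (4 * C) * sqrt (\<integral>x. (k n x)\<^sup>2 \<partial>M)"
      by (intro mult_right_mono real_sqrt_le_mono dbd) auto
    finally show "norm (\<integral>x. \<bar>u n x - v x\<bar> * \<bar>h x\<bar> \<partial>M) \<le> (\<integral>x. min \<bar>u n x - v x\<bar> 1 * \<bar>h x\<bar> \<partial>M) + sqrt (4 * C) * sqrt (\<integral>x. (k n x)\<^sup>2 \<partial>M)"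
      by simp
  next
    have "(\<lambda>n. (\<integral>x. min \<bar>u n x - v x\<bar> 1 * \<bar>h x\<bar> \<partial>M) + sqrt (4 * C) * sqrt (\<integral>x. (k n x)\<^sup>2 \<partial>M)) \<longlonglongrightarrow> 0 + sqrt (4 * C) * sqrt 0"
      using m0 k0 by (intro tendsto_intros) auto
    then show "(\<lambda>n. (\<integral>x. min \<bar>u n x - v x\<bar> 1 * \<bar>h x\<bar> \<partial>M) + sqrt (4 * C) * sqrt (\<integral>x. (k n x)\<^sup>2 \<partial>M)) \<longlonglongrightarrow> 0" by simp
  qed
qed

text \<open>The error splits as u (w - h) + (u - v) h: the first term is small by strong convergence
  of \<open>w\<close> and boundedness of \<open>u\<close>, the second by the preceding
  lemma.\<close>

lemma integral_mult_tendsto_weak_strong: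
  fixes u w :: "nat \<Rightarrow> 'a \<Rightarrow> real"
  assumes [measurable]: "\<And>n. u n \<in> borel_measurable M" "v \<in> borel_measurable M"
      "\<And>n. w n \<in> borel_measurable M" "h \<in> borel_measurable M"
    and int: "\<And>n. integrable M (\<lambda>x. (u n x)\<^sup>2)"
    and bd: "\<And>n. (\<integral>x. (u n x)\<^sup>2 \<partial>M) \<le> C"
    and lim: "AE x in M. (\<lambda>n. u n x) \<longlonglongrightarrow> v x"
    and w: "\<And>n. integrable M (\<lambda>x. (w n x)\<^sup>2)"
    and h: "integrable M (\<lambda>x. (h x)\<^sup>2)" "integrable M h"
    and wh: "(\<lambda>n. \<integral>x. (w n x - h x)\<^sup>2 \<partial>M) \<longlonglongrightarrow> 0"
  shows "(\<lambda>n. \<integral>x. u n x * w n x \<partial>M) \<longlonglongrightarrow> (\<integral>x. v x * h x \<partial>M)"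
proof (rule LIM_zero_cancel, rule Lim_null_comparison[OF always_eventually, OF allI])
  note v = square_integrable_AE_limit[OF assms(1,2) int bd lim]
  have dw: "integrable M (\<lambda>x. (w n x - h x)\<^sup>2)" for n by (intro square_integrable_diff w h) measurable
  have du: "integrable M (\<lambda>x. (u n x - v x)\<^sup>2)" for n by (intro square_integrable_diff int v) measurable
  fix n
  have i: "integrable M (\<lambda>x. u n x * w n x)" "integrable M (\<lambda>x. v x * h x)"
      "integrable M (\<lambda>x. u n x * (w n x - h x))" "integrable M (\<lambda>x. (u n x - v x) * h x)"
    by (intro square_integrable_mult dw w du v h int; measurable)+
  have "\<bar>(\<integral>x. u n x * w n x \<partial>M) - (\<integral>x. v x * h x \<partial>M)\<bar> = \<bar>\<integral>x. u n x * w n x - v x * h x \<partial>M\<bar>"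
    using i by simp
  also have "\<dots> \<le> (\<integral>x. \<bar>u n x * w n x - v x * h x\<bar> \<partial>M)" by (rule integral_abs_bound)
  also have "\<dots> \<le> (\<integral>x. \<bar>u n x * (w n x - h x)\<bar> + \<bar>(u n x - v x) * h x\<bar> \<partial>M)"
  proof (rule integral_mono)
    fix x
    have "u n x * w n x - v x * h x = u n x * (w n x - h x) + (u n x - v x) * h x" by (simp add: algebra_simps)
    then show "\<bar>u n x * w n x - v x * h x\<bar> \<le> \<bar>u n x * (w n x - h x)\<bar> + \<bar>(u n x - v x) * h x\<bar>" by simp
  qed (use i in auto)
  also have "\<dots> = (\<integral>x. \<bar>u n x * (w n x - h x)\<bar> \<partial>M) + (\<integral>x. \<bar>u n x - v x\<bar> * \<bar>h x\<bar> \<partial>M)"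
    unfolding abs_mult[of "u n _ - v _", symmetric] by (intro Bochner_Integration.integral_add integrable_abs i)
  also have "(\<integral>x. \<bar>u n x * (w n x - h x)\<bar> \<partial>M) \<le> sqrt (\<integral>x. (u n x)\<^sup>2 \<partial>M) * sqrt (\<integral>x. (w n x - h x)\<^sup>2 \<partial>M)"
    by (intro Cauchy_Schwarz_abs_integral dw int) measurable
  also have "\<dots> \<le> sqrt C * sqrt (\<integral>x. (w n x - h x)\<^sup>2 \<partial>M)"
    by (intro mult_right_mono real_sqrt_le_mono bd) auto
  finally show "norm ((\<integral>x. u n x * w n x \<partial>M) - (\<integral>x. v x * h x \<partial>M)) \<le>
      sqrt C * sqrt (\<integral>x. (w n x - h x)\<^sup>2 \<partial>M) + (\<integral>x. \<bar>u n x - v x\<bar> * \<bar>h x\<bar> \<partial>M)" by simp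
next
  have "(\<lambda>n. sqrt C * sqrt (\<integral>x. (w n x - h x)\<^sup>2 \<partial>M) + (\<integral>x. \<bar>u n x - v x\<bar> * \<bar>h x\<bar> \<partial>M)) \<longlonglongrightarrow> sqrt C * sqrt 0 + 0"
    by (intro tendsto_intros wh weak_L2_convergence_if_AE_and_bounded[OF assms(1,2,4) int bd lim h])
  then show "(\<lambda>n. sqrt C * sqrt (\<integral>x. (w n x - h x)\<^sup>2 \<partial>M) + (\<integral>x. \<bar>u n x - v x\<bar> * \<bar>h x\<bar> \<partial>M)) \<longlonglongrightarrow> 0" by simp
qed

text \<open>In the martingale condition the test function is evaluated at the varying point
  \<open>X n\<close>. The error splits as f(X n) (u - v) + (f(X n) - f(X')) v: the first part is at
  most the L1 distance of \<open>u n\<close> and \<open>v\<close>, which vanishes by the weak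
  convergence lemma with h = 1; the second vanishes by dominated convergence.\<close>

lemma (in prob_space) integral_continuous_mult_tendsto:
  fixes u :: "nat \<Rightarrow> 'a \<Rightarrow> real" and X :: "nat \<Rightarrow> 'a \<Rightarrow> 'b::metric_space"
  assumes [measurable]: "\<And>n. u n \<in> borel_measurable M" "v \<in> borel_measurable M"
      "\<And>n. X n \<in> borel_measurable M" "X' \<in> borel_measurable M"
    and int: "\<And>n. integrable M (\<lambda>x. (u n x)\<^sup>2)"
    and bd: "\<And>n. (\<integral>x. (u n x)\<^sup>2 \<partial>M) \<le> C"
    and lim: "AE x in M. (\<lambda>n. u n x) \<longlonglongrightarrow> v x"
    and limX: "AE x in M. (\<lambda>n. X n x) \<longlonglongrightarrow> X' x"
    and f: "continuous_on UNIV f" "\<And>y. 0 \<le> f y" "\<And>y. f y \<le> (1::real)"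
  shows "(\<lambda>n. \<integral>x. f (X n x) * u n x \<partial>M) \<longlonglongrightarrow> (\<integral>x. f (X' x) * v x \<partial>M)"
proof (rule LIM_zero_cancel, rule Lim_null_comparison[OF always_eventually, OF allI])
  have [measurable]: "f \<in> borel_measurable borel" using f(1) by (rule borel_measurable_continuous_onI)
  note v = square_integrable_AE_limit[OF assms(1,2) int bd lim]
  have iu: "integrable M (u n)" for n by (rule square_integrable_imp_integrable[OF _ int]) measurable
  have iv: "integrable M v" by (rule square_integrable_imp_integrable[OF _ v(1)]) measurable
  have fb: "\<bar>f y * a\<bar> \<le> \<bar>a\<bar>" for y a using f(2,3)[of y] by (simp add: abs_mult mult_left_le_one_le)
  fix n
  have i: "integrable M (\<lambda>x. f (X n x) * u n x)" "integrable M (\<lambda>x. f (X' x) * v x)" "integrable M (\<lambda>x. f (X n x) * v x)"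
    by (rule Bochner_Integration.integrable_bound[OF iu[of n]] Bochner_Integration.integrable_bound[OF iv]; simp add: fb)+
  have "\<bar>(\<integral>x. f (X n x) * u n x \<partial>M) - (\<integral>x. f (X' x) * v x \<partial>M)\<bar> = \<bar>\<integral>x. f (X n x) * u n x - f (X' x) * v x \<partial>M\<bar>"
    using i by simp
  also have "\<dots> \<le> (\<integral>x. \<bar>f (X n x) * u n x - f (X' x) * v x\<bar> \<partial>M)" by (rule integral_abs_bound)
  also have "\<dots> \<le> (\<integral>x. \<bar>u n x - v x\<bar> * \<bar>1\<bar> + \<bar>f (X n x) * v x - f (X' x) * v x\<bar> \<partial>M)"
  proof (rule integral_mono)
    fix x
    have "f (X n x) * u n x - f (X' x) * v x = f (X n x) * (u n x - v x) + (f (X n x) * v x - f (X' x) * v x)"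
      by (simp add: algebra_simps)
    then show "\<bar>f (X n x) * u n x - f (X' x) * v x\<bar> \<le> \<bar>u n x - v x\<bar> * \<bar>1\<bar> + \<bar>f (X n x) * v x - f (X' x) * v x\<bar>"
      using fb[of "X n x" "u n x - v x"] by (simp only: abs_one mult_1_right)
  qed (use i iu iv in auto)
  also have "\<dots> = (\<integral>x. \<bar>u n x - v x\<bar> * \<bar>1\<bar> \<partial>M) + (\<integral>x. \<bar>f (X n x) * v x - f (X' x) * v x\<bar> \<partial>M)"
    using i iu iv by simp
  finally show "norm ((\<integral>x. f (X n x) * u n x \<partial>M) - (\<integral>x. f (X' x) * v x \<partial>M)) \<le>
    (\<integral>x. \<bar>u n x - v x\<bar> * \<bar>1\<bar> \<partial>M) + (\<integral>x. \<bar>f (X n x) * v x - f (X' x) * v x\<bar> \<partial>M)" by simp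
next
  have [measurable]: "f \<in> borel_measurable borel" using f(1) by (rule borel_measurable_continuous_onI)
  note v = square_integrable_AE_limit[OF assms(1,2) int bd lim]
  have iv: "integrable M v" by (rule square_integrable_imp_integrable[OF _ v(1)]) measurable
  have "(\<lambda>n. \<integral>x. \<bar>f (X n x) * v x - f (X' x) * v x\<bar> \<partial>M) \<longlonglongrightarrow> (\<integral>x. 0 \<partial>M)"
  proof (rule integral_dominated_convergence[where w="\<lambda>x. 2 * \<bar>v x\<bar>"])
    show "AE x in M. (\<lambda>n. \<bar>f (X n x) * v x - f (X' x) * v x\<bar>) \<longlonglongrightarrow> 0" using limX
    proof eventually_elim
      fix x assume "(\<lambda>n. X n x) \<longlonglongrightarrow> X' x"
      then have "(\<lambda>n. f (X n x)) \<longlonglongrightarrow> f (X' x)"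
        using f(1) by (auto simp: continuous_on_eq_continuous_at intro: isCont_tendsto_compose)
      then have "(\<lambda>n. \<bar>f (X n x) * v x - f (X' x) * v x\<bar>) \<longlonglongrightarrow> \<bar>f (X' x) * v x - f (X' x) * v x\<bar>" by (intro tendsto_intros)
      then show "(\<lambda>n. \<bar>f (X n x) * v x - f (X' x) * v x\<bar>) \<longlonglongrightarrow> 0" by simp
    qed
    show "AE x in M. norm \<bar>f (X n x) * v x - f (X' x) * v x\<bar> \<le> 2 * \<bar>v x\<bar>" for n
    proof (intro AE_I2)
      fix x
      have "\<bar>f y * v x\<bar> \<le> \<bar>v x\<bar>" for y using f(2,3)[of y] by (simp add: abs_mult mult_left_le_one_le)
      from this[of "X n x"] this[of "X' x"] show "norm \<bar>f (X n x) * v x - f (X' x) * v x\<bar> \<le> 2 * \<bar>v x\<bar>"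
        by (simp only: real_norm_def)
    qed
  qed (use iv in auto)
  then have "(\<lambda>n. (\<integral>x. \<bar>u n x - v x\<bar> * \<bar>1\<bar> \<partial>M) + (\<integral>x. \<bar>f (X n x) * v x - f (X' x) * v x\<bar> \<partial>M)) \<longlonglongrightarrow> 0 + (\<integral>x. 0 \<partial>M)"
    by (intro tendsto_add weak_L2_convergence_if_AE_and_bounded[OF assms(1,2) _ int bd lim]) auto
  then show "(\<lambda>n. (\<integral>x. \<bar>u n x - v x\<bar> * \<bar>1\<bar> \<partial>M) + (\<integral>x. \<bar>f (X n x) * v x - f (X' x) * v x\<bar> \<partial>M)) \<longlonglongrightarrow> 0"
    by simp
qed

text \<open>Indicators of open sets are limits of continuous functions with values in [0, 1], and a
  Dynkin system argument reaches all Borel sets. Allowing two pairs (X, W) and (Y, V) covers both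
  uses: equality of laws (W = V = 1) and the martingale condition (X = Y).\<close>

lemma integral_indicator_eq_if_continuous_eq:
  fixes W V :: "'a \<Rightarrow> real" and X Y :: "'a \<Rightarrow> 'b::metric_space"
  assumes [measurable]: "X \<in> borel_measurable M" "Y \<in> borel_measurable M"
    and W: "integrable M W" and V: "integrable M V"
    and eq: "\<And>f :: 'b \<Rightarrow> real. continuous_on UNIV f \<Longrightarrow> (\<And>y. 0 \<le> f y) \<Longrightarrow> (\<And>y. f y \<le> 1) \<Longrightarrow>
      (\<integral>x. f (X x) * W x \<partial>M) = (\<integral>x. f (Y x) * V x \<partial>M)"
    and A: "A \<in> sets borel"
  shows "(\<integral>x. indicator A (X x) * W x \<partial>M) = (\<integral>x. indicator A (Y x) * V x \<partial>M)"
proof -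
  have lim: "(\<lambda>n. \<integral>x. min 1 (real n * infdist (Z x) (- U)) * h x \<partial>M) \<longlonglongrightarrow> (\<integral>x. indicator U (Z x) * h x \<partial>M)"
    if U: "open U" "U \<noteq> UNIV" and [measurable]: "Z \<in> borel_measurable M" and h: "integrable M h" for U :: "'b set" and Z h
  proof (rule integral_dominated_convergence[where w="\<lambda>x. \<bar>h x\<bar>"])
    have [measurable]: "U \<in> sets borel" using U by auto
    have [measurable]: "h \<in> borel_measurable M" using h by auto
    have [measurable]: "(\<lambda>x. infdist x (- U)) \<in> borel_measurable borel"
      by (intro borel_measurable_continuous_onI continuous_intros)
    show "(\<lambda>x. indicator U (Z x) * h x) \<in> borel_measurable M"
      "(\<lambda>x. min 1 (real n * infdist (Z x) (- U)) * h x) \<in> borel_measurable M" for n by measurable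
    show "AE x in M. norm (min 1 (real n * infdist (Z x) (- U)) * h x) \<le> \<bar>h x\<bar>" for n
      by (auto simp: abs_mult infdist_nonneg intro!: mult_left_le_one_le)
    have "(\<lambda>n. min 1 (real n * infdist z (- U))) \<longlonglongrightarrow> indicator U z" for z
    proof (cases "z \<in> U")
      case True
      then have "infdist z (- U) > 0"
        using U in_closed_iff_infdist_zero[of "- U" z] infdist_nonneg[of z "- U"] by (auto simp: less_le)
      then have "filterlim (\<lambda>n. real n * infdist z (- U)) at_top sequentially" by real_asymp
      then have "\<forall>\<^sub>F n in sequentially. 1 \<le> real n * infdist z (- U)" by (simp add: filterlim_at_top)
      then have "\<forall>\<^sub>F n in sequentially. min 1 (real n * infdist z (- U)) = 1" by eventually_elim simp
      then show ?thesis using True by (simp add: tendsto_eventually)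
    next
      case False
      then show ?thesis by simp
    qed
    then show "AE x in M. (\<lambda>n. min 1 (real n * infdist (Z x) (- U)) * h x) \<longlonglongrightarrow> indicator U (Z x) * h x"
      by (intro AE_I2 tendsto_intros)
  qed (use h in auto)
  have "Int_stable {U :: 'b set. open U}" "{U :: 'b set. open U} \<subseteq> Pow UNIV" "A \<in> sigma_sets UNIV {U. open U}"
    using A by (auto simp: borel_def Int_stable_def)
  then show ?thesis
  proof (induction rule: sigma_sets_induct_disjoint)
    case (basic U)
    show ?case
    \<comment> \<open>\<open>infdist\<close> to the empty set is 0 by convention, so the
      approximating functions would vanish for the whole space; there the constant 1 is itself a
      test function.\<close>
    proof (cases "U = UNIV")
      case True
      then show ?thesis using eq[of "\<lambda>_. 1"] by simp
    next
      case False
      have "(\<lambda>n. \<integral>x. min 1 (real n * infdist (X x) (- U)) * W x \<partial>M) = (\<lambda>n. \<integral>x. min 1 (real n * infdist (Y x) (- U)) * V x \<partial>M)"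
        by (intro ext eq continuous_intros) (auto simp: infdist_nonneg)
      then show ?thesis
        using LIMSEQ_unique lim[of U X W] lim[of U Y V] False basic W V by auto
    qed
  next
    case (compl B)
    then have B [measurable]: "B \<in> sets borel" by (simp add: borel_def)
    have "(\<integral>x. indicator (UNIV - B) (Z x) * h x \<partial>M) = (\<integral>x. h x \<partial>M) - (\<integral>x. indicator B (Z x) * h x \<partial>M)"
      if h: "integrable M h" and [measurable]: "Z \<in> borel_measurable M" for Z and h :: "'a \<Rightarrow> real"
    proof -
      have [measurable]: "h \<in> borel_measurable M" using h by auto
      have "integrable M (\<lambda>x. indicator B (Z x) * h x)"
        by (rule Bochner_Integration.integrable_bound[OF h]) (auto simp: indicator_def)
      then have "(\<integral>x. h x \<partial>M) - (\<integral>x. indicator B (Z x) * h x \<partial>M) = (\<integral>x. h x - indicator B (Z x) * h x \<partial>M)"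
        using h by simp
      also have "\<dots> = (\<integral>x. indicator (UNIV - B) (Z x) * h x \<partial>M)"
        by (intro Bochner_Integration.integral_cong) (auto simp: indicator_def)
      finally show ?thesis ..
    qed
    then show ?case using compl W V eq[of "\<lambda>_. 1"] by simp
  next
    case (union B)
    then have B [measurable]: "B i \<in> sets borel" for i by (auto simp: borel_def)
    have "(\<integral>x. indicator (\<Union> (range B)) (Z x) * h x \<partial>M) = (\<Sum>i. \<integral>x. indicator (B i) (Z x) * h x \<partial>M)"
      if h: "integrable M h" and [measurable]: "Z \<in> borel_measurable M" for Z and h :: "'a \<Rightarrow> real"
    proof -
      have [measurable]: "h \<in> borel_measurable M" using h by auto
      have ind: "(\<integral>x. indicator D (Z x) * h x \<partial>M) = (\<integral>x\<in>Z -` D \<inter> space M. h x \<partial>M)" for D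
        unfolding set_lebesgue_integral_def by (intro Bochner_Integration.integral_cong) (auto simp: indicator_def)
      have "(\<integral>x\<in>(\<Union>i. Z -` B i \<inter> space M). h x \<partial>M) = (\<Sum>i. \<integral>x\<in>Z -` B i \<inter> space M. h x \<partial>M)"
      proof (rule lebesgue_integral_countable_add)
        show "set_integrable M (\<Union>i. Z -` B i \<inter> space M) h"
          unfolding set_integrable_def by (rule Bochner_Integration.integrable_bound[OF h]) (auto simp: indicator_def)
        show "Z -` B i \<inter> space M \<inter> (Z -` B j \<inter> space M) = {}" if "i \<noteq> j" for i j
          using union(1) that by (auto simp: disjoint_family_on_def)
      qed measurable
      moreover have "(\<Union>i. Z -` B i \<inter> space M) = Z -` \<Union> (range B) \<inter> space M" by auto
      ultimately show ?thesis by (simp add: ind)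
    qed
    then show ?case using union W V by simp
  qed simp
qed

section \<open>Barycentric pairs\<close>

text \<open>The sets of the generated sigma-algebra are exactly the preimages of Borel sets under
  \<open>W\<close>, so the conditional expectation is characterised by integrals. In this form the
  condition depends only on a joint law and can be passed to limits.\<close>

lemma real_cond_exp_vimage_iff:
  fixes f :: "'a \<Rightarrow> real" and g :: "'b::topological_space \<Rightarrow> real"
  assumes "prob_space M" and [measurable]: "W \<in> borel_measurable M" "g \<in> borel_measurable borel"
    and f: "integrable M f" and g: "integrable M (\<lambda>\<omega>. g (W \<omega>))"
  shows "(AE \<omega> in M. real_cond_exp M (vimage_algebra (space M) W borel) f \<omega> = g (W \<omega>)) \<longleftrightarrow>
    (\<forall>A\<in>sets borel. (\<integral>\<omega>. indicator A (W \<omega>) * f \<omega> \<partial>M) = (\<integral>\<omega>. indicator A (W \<omega>) * g (W \<omega>) \<partial>M))"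
proof -
  interpret prob_space M by fact
  let ?F = "vimage_algebra (space M) W borel"
  have sF: "sets ?F = {W -` A \<inter> space M |A. A \<in> sets borel}"
    by (rule sets_vimage_algebra2) auto
  interpret finite_measure_subalgebra M ?F
    by unfold_locales (auto simp: subalgebra_def sF)
  have WF [measurable]: "W \<in> measurable ?F borel" by (rule measurable_vimage_algebra1) auto
  have *: "(\<integral>\<omega>\<in>W -` A \<inter> space M. h \<omega> \<partial>M) = (\<integral>\<omega>. indicator A (W \<omega>) * h \<omega> \<partial>M)" for A and h :: "'a \<Rightarrow> real"
    unfolding set_lebesgue_integral_def
    by (intro Bochner_Integration.integral_cong) (auto simp: indicator_def)
  show ?thesis
  proof safe
    fix A :: "'b set" assume ae: "AE \<omega> in M. real_cond_exp M ?F f \<omega> = g (W \<omega>)" and A [measurable]: "A \<in> sets borel"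
    have "(\<integral>\<omega>. indicator A (W \<omega>) * f \<omega> \<partial>M) = (\<integral>\<omega>. indicator A (W \<omega>) * real_cond_exp M ?F f \<omega> \<partial>M)"
      unfolding *[symmetric] using A by (intro real_cond_exp_intA f) (auto simp: sF)
    also have "\<dots> = (\<integral>\<omega>. indicator A (W \<omega>) * g (W \<omega>) \<partial>M)"
      by (intro integral_cong_AE) (use ae in auto)
    finally show "(\<integral>\<omega>. indicator A (W \<omega>) * f \<omega> \<partial>M) = (\<integral>\<omega>. indicator A (W \<omega>) * g (W \<omega>) \<partial>M)" .
  next
    assume "\<forall>A\<in>sets borel. (\<integral>\<omega>. indicator A (W \<omega>) * f \<omega> \<partial>M) = (\<integral>\<omega>. indicator A (W \<omega>) * g (W \<omega>) \<partial>M)"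
    then show "AE \<omega> in M. real_cond_exp M ?F f \<omega> = g (W \<omega>)"
      by (intro real_cond_exp_charact f g) (auto simp: sF *)
  qed
qed

text \<open>Extends the test functions from indicators to all measurable \<open>h\<close> with
  integrable product, by pulling the factor h(W) out of the conditional expectation.\<close>

lemma integral_mult_if_indicator_eq:
  fixes f :: "'a \<Rightarrow> real" and g h :: "'b::topological_space \<Rightarrow> real"
  assumes "prob_space M" and [measurable]: "W \<in> borel_measurable M" "g \<in> borel_measurable borel" "h \<in> borel_measurable borel"
    and f: "integrable M f" and g: "integrable M (\<lambda>\<omega>. g (W \<omega>))"
    and eq: "\<And>A. A \<in> sets borel \<Longrightarrow> (\<integral>\<omega>. indicator A (W \<omega>) * f \<omega> \<partial>M) = (\<integral>\<omega>. indicator A (W \<omega>) * g (W \<omega>) \<partial>M)"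
    and hf: "integrable M (\<lambda>\<omega>. h (W \<omega>) * f \<omega>)"
  shows "(\<integral>\<omega>. h (W \<omega>) * f \<omega> \<partial>M) = (\<integral>\<omega>. h (W \<omega>) * g (W \<omega>) \<partial>M)"
proof -
  interpret prob_space M by fact
  let ?F = "vimage_algebra (space M) W borel"
  have sF: "sets ?F = {W -` A \<inter> space M |A. A \<in> sets borel}"
    by (rule sets_vimage_algebra2) auto
  interpret finite_measure_subalgebra M ?F
    by unfold_locales (auto simp: subalgebra_def sF)
  have [measurable]: "W \<in> measurable ?F borel" by (rule measurable_vimage_algebra1) auto
  have ae: "AE \<omega> in M. real_cond_exp M ?F f \<omega> = g (W \<omega>)"
    using real_cond_exp_vimage_iff[OF assms(1-3) f g] eq by blast
  have "(\<integral>\<omega>. h (W \<omega>) * f \<omega> \<partial>M) = (\<integral>\<omega>. h (W \<omega>) * real_cond_exp M ?F f \<omega> \<partial>M)"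
    using f by (intro real_cond_exp_intg(2)[symmetric] hf) auto
  also have "\<dots> = (\<integral>\<omega>. h (W \<omega>) * g (W \<omega>) \<partial>M)"
    by (intro integral_cong_AE) (use ae in auto)
  finally show ?thesis .
qed

text \<open>The common core of \<open>Gamma\<close> and \<open>Xset\<close>: the relation E[Y|X] = X
  in integral form, bundled with measurability and second moments, for random variables on an
  arbitrary space.\<close>

definition barycentric :: "'a measure \<Rightarrow> ('a \<Rightarrow> real \<times> real) \<Rightarrow> ('a \<Rightarrow> real \<times> real) \<Rightarrow> bool" where
  "barycentric M X Y \<longleftrightarrow> X \<in> borel_measurable M \<and> Y \<in> borel_measurable M \<and>
     integrable M (\<lambda>\<omega>. (norm (X \<omega>))\<^sup>2) \<and> integrable M (\<lambda>\<omega>. (norm (Y \<omega>))\<^sup>2) \<and>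
     (\<forall>A\<in>sets borel. (\<integral>\<omega>. indicator A (X \<omega>) * fst (Y \<omega>) \<partial>M) = (\<integral>\<omega>. indicator A (X \<omega>) * fst (X \<omega>) \<partial>M) \<and>
                     (\<integral>\<omega>. indicator A (X \<omega>) * snd (Y \<omega>) \<partial>M) = (\<integral>\<omega>. indicator A (X \<omega>) * snd (X \<omega>) \<partial>M))"

lemma norm_sq_prod: "(norm (p :: 'a::real_normed_vector \<times> 'b::real_normed_vector))\<^sup>2 = (norm (fst p))\<^sup>2 + (norm (snd p))\<^sup>2"
  by (cases p) (simp add: norm_Pair)

lemma integrable_norm_sq_prod_iff:
  fixes X :: "'a \<Rightarrow> 'b::{real_normed_vector,second_countable_topology} \<times> 'c::{real_normed_vector,second_countable_topology}"
  assumes [measurable]: "X \<in> borel_measurable M"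
  shows "integrable M (\<lambda>\<omega>. (norm (X \<omega>))\<^sup>2) \<longleftrightarrow>
    integrable M (\<lambda>\<omega>. (norm (fst (X \<omega>)))\<^sup>2) \<and> integrable M (\<lambda>\<omega>. (norm (snd (X \<omega>)))\<^sup>2)"
proof safe
  assume i: "integrable M (\<lambda>\<omega>. (norm (X \<omega>))\<^sup>2)"
  show "integrable M (\<lambda>\<omega>. (norm (fst (X \<omega>)))\<^sup>2)" "integrable M (\<lambda>\<omega>. (norm (snd (X \<omega>)))\<^sup>2)"
    by (rule Bochner_Integration.integrable_bound[OF i]; auto simp: norm_sq_prod)+
qed (auto simp: norm_sq_prod)

context
  fixes M :: "'a measure" and X :: "'a \<Rightarrow> real \<times> real"
  assumes M: "prob_space M" and X [measurable]: "X \<in> borel_measurable M" and sq: "integrable M (\<lambda>\<omega>. (norm (X \<omega>))\<^sup>2)"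
begin

lemma square_integrable_components:
  "integrable M (\<lambda>\<omega>. (fst (X \<omega>))\<^sup>2)" "integrable M (\<lambda>\<omega>. (snd (X \<omega>))\<^sup>2)"
  using sq integrable_norm_sq_prod_iff[OF X] by auto

lemma integrable_components:
  "integrable M (\<lambda>\<omega>. fst (X \<omega>))" "integrable M (\<lambda>\<omega>. snd (X \<omega>))"
  using square_integrable_components by (auto intro!: finite_measure.square_integrable_imp_integrable[OF prob_space.axioms(1)[OF M]])

end

lemma cond_exp_given_eq_iff_barycentric:
  assumes M: "prob_space M" and X [measurable]: "X \<in> borel_measurable M" and Y [measurable]: "Y \<in> borel_measurable M"
    and sX: "integrable M (\<lambda>\<omega>. (norm (X \<omega>))\<^sup>2)" and sY: "integrable M (\<lambda>\<omega>. (norm (Y \<omega>))\<^sup>2)"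
  shows "cond_exp_given_eq M Y X \<longleftrightarrow> barycentric M X Y"
proof -
  note iX = integrable_components[OF M X sX] and iY = integrable_components[OF M Y sY]
  show ?thesis
    unfolding cond_exp_given_eq_def barycentric_def
    using real_cond_exp_vimage_iff[OF M X borel_measurable_fst_snd(1) iY(1) iX(1)]
      real_cond_exp_vimage_iff[OF M X borel_measurable_fst_snd(2) iY(2) iX(2)] X Y sX sY
    by simp blast
qed

text \<open>Only integrals of functions of the pair enter the definition, so it can be transported
  freely between plans and random variables representing them.\<close>

lemma barycentric_distr_iff:
  assumes [measurable]: "Z \<in> measurable \<Omega> N" "X \<in> borel_measurable N" "Y \<in> borel_measurable N"
  shows "barycentric (distr \<Omega> N Z) X Y \<longleftrightarrow> barycentric \<Omega> (\<lambda>\<omega>. X (Z \<omega>)) (\<lambda>\<omega>. Y (Z \<omega>))"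
proof -
  have "(\<integral>\<omega>. indicator A (X \<omega>) * f \<omega> \<partial>distr \<Omega> N Z) = (\<integral>\<omega>. indicator A (X (Z \<omega>)) * f (Z \<omega>) \<partial>\<Omega>)"
    if [measurable]: "A \<in> sets borel" "f \<in> borel_measurable N" for A and f :: "_ \<Rightarrow> real"
    by (subst integral_distr) auto
  then show ?thesis unfolding barycentric_def by (simp add: integrable_distr_eq)
qed

lemma borel_measurable_proj:
  fixes \<gamma> :: "((real \<times> real) \<times> (real \<times> real)) measure"
  assumes "sets \<gamma> = sets borel"
  shows "fst \<in> borel_measurable \<gamma>" "snd \<in> borel_measurable \<gamma>"
  unfolding measurable_cong_sets[OF assms refl] by measurable

lemma Gamma_iff_barycentric:
  "\<gamma> \<in> Gamma \<nu> \<longleftrightarrow> prob_space \<gamma> \<and> sets \<gamma> = sets borel \<and> distr \<gamma> borel snd = \<nu> \<and> barycentric \<gamma> fst snd"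
proof (cases "prob_space \<gamma> \<and> sets \<gamma> = sets borel")
  case True
  then have "(\<lambda>z. z) \<in> borel_measurable \<gamma>" by (auto cong: measurable_cong_sets)
  with True borel_measurable_proj[of \<gamma>] cond_exp_given_eq_iff_barycentric[of \<gamma> fst snd] integrable_norm_sq_prod_iff[of "\<lambda>z. z" \<gamma>]
  show ?thesis unfolding Gamma_def by (auto simp: barycentric_def)
qed (auto simp: Gamma_def)

lemma distr_Pair_in_Gamma_iff:
  assumes "prob_space \<Omega>" "X \<in> borel_measurable \<Omega>" "Y \<in> borel_measurable \<Omega>"
  shows "distr \<Omega> borel (\<lambda>\<omega>. (X \<omega>, Y \<omega>)) \<in> Gamma \<nu> \<longleftrightarrow> distr \<Omega> borel Y = \<nu> \<and> barycentric \<Omega> X Y"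
proof -
  have P: "(\<lambda>\<omega>. (X \<omega>, Y \<omega>)) \<in> borel_measurable \<Omega>" using assms by simp
  have b: "fst \<in> borel_measurable (borel :: ((real \<times> real) \<times> (real \<times> real)) measure)"
    "snd \<in> borel_measurable (borel :: ((real \<times> real) \<times> (real \<times> real)) measure)"
    using borel_measurable_proj[of borel] by auto
  show ?thesis
    unfolding Gamma_iff_barycentric
    using assms P b by (simp add: prob_space.prob_space_distr distr_distr comp_def barycentric_distr_iff)
qed

lemma measurable_vimage_algebra_comp:
  assumes "Y \<in> measurable M N" "X \<in> measurable (vimage_algebra (space M) Y N) L"
  shows "X \<in> measurable M L"
proof -
  have "sets (vimage_algebra (space M) Y N) \<subseteq> sets M"
    using assms(1) by (auto simp: sets_vimage_algebra2 measurable_space intro: measurable_sets)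
  then show ?thesis using assms(2) by (auto simp: measurable_def)
qed

lemma Xset_iff_barycentric:
  assumes M: "prob_space M" and Y: "Y \<in> borel_measurable M" "integrable M (\<lambda>\<omega>. (norm (Y \<omega>))\<^sup>2)"
  shows "X \<in> Xset M Y \<longleftrightarrow> X \<in> measurable (vimage_algebra (space M) Y borel) borel \<and> barycentric M X Y"
proof (cases "X \<in> measurable (vimage_algebra (space M) Y borel) borel")
  case True
  have "X \<in> borel_measurable M"
    by (rule measurable_vimage_algebra_comp[OF Y(1) True])
  then show ?thesis using True cond_exp_given_eq_iff_barycentric[OF M _ Y(1)] Y unfolding Xset_def by (auto simp: barycentric_def)
qed (auto simp: Xset_def)

text \<open>The coordinates of X serve as test functions \<open>h (X)\<close>; square integrability
  of both variables makes the products integrable.\<close>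

lemma barycentric_integral_mult:
  assumes M: "prob_space M" and b: "barycentric M X Y"
  shows "(\<integral>\<omega>. fst (X \<omega>) * fst (Y \<omega>) \<partial>M) = (\<integral>\<omega>. (fst (X \<omega>))\<^sup>2 \<partial>M)"
    and "(\<integral>\<omega>. snd (X \<omega>) * snd (Y \<omega>) \<partial>M) = (\<integral>\<omega>. (snd (X \<omega>))\<^sup>2 \<partial>M)"
    and "(\<integral>\<omega>. fst (X \<omega>) * snd (Y \<omega>) \<partial>M) = (\<integral>\<omega>. fst (X \<omega>) * snd (X \<omega>) \<partial>M)"
    and "(\<integral>\<omega>. snd (X \<omega>) * fst (Y \<omega>) \<partial>M) = (\<integral>\<omega>. fst (X \<omega>) * snd (X \<omega>) \<partial>M)"
proof -
  have X [measurable]: "X \<in> borel_measurable M" and Y [measurable]: "Y \<in> borel_measurable M"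
    and sX: "integrable M (\<lambda>\<omega>. (norm (X \<omega>))\<^sup>2)" and sY: "integrable M (\<lambda>\<omega>. (norm (Y \<omega>))\<^sup>2)"
    using b by (auto simp: barycentric_def)
  note iX = integrable_components[OF M X sX] and iY = integrable_components[OF M Y sY]
  note sX = square_integrable_components[OF M X sX] and sY = square_integrable_components[OF M Y sY]
  have 1: "(\<integral>\<omega>. h (X \<omega>) * fst (Y \<omega>) \<partial>M) = (\<integral>\<omega>. h (X \<omega>) * fst (X \<omega>) \<partial>M)"
    if [measurable]: "h \<in> borel_measurable borel" and "integrable M (\<lambda>\<omega>. (h (X \<omega>))\<^sup>2)" for h
  proof (rule integral_mult_if_indicator_eq[where h=h and g=fst, OF M X _ _ iY(1) iX(1)])
    show "integrable M (\<lambda>\<omega>. h (X \<omega>) * fst (Y \<omega>))" by (intro square_integrable_mult that sY) measurable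
  qed (use b in \<open>auto simp: barycentric_def\<close>)
  have 2: "(\<integral>\<omega>. h (X \<omega>) * snd (Y \<omega>) \<partial>M) = (\<integral>\<omega>. h (X \<omega>) * snd (X \<omega>) \<partial>M)"
    if [measurable]: "h \<in> borel_measurable borel" and "integrable M (\<lambda>\<omega>. (h (X \<omega>))\<^sup>2)" for h
  proof (rule integral_mult_if_indicator_eq[where h=h and g=snd, OF M X _ _ iY(2) iX(2)])
    show "integrable M (\<lambda>\<omega>. h (X \<omega>) * snd (Y \<omega>))" by (intro square_integrable_mult that sY) measurable
  qed (use b in \<open>auto simp: barycentric_def\<close>)
  show "(\<integral>\<omega>. fst (X \<omega>) * fst (Y \<omega>) \<partial>M) = (\<integral>\<omega>. (fst (X \<omega>))\<^sup>2 \<partial>M)"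
    using 1[of fst] sX by (simp add: power2_eq_square)
  show "(\<integral>\<omega>. snd (X \<omega>) * snd (Y \<omega>) \<partial>M) = (\<integral>\<omega>. (snd (X \<omega>))\<^sup>2 \<partial>M)"
    using 2[of snd] sX by (simp add: power2_eq_square)
  show "(\<integral>\<omega>. fst (X \<omega>) * snd (Y \<omega>) \<partial>M) = (\<integral>\<omega>. fst (X \<omega>) * snd (X \<omega>) \<partial>M)"
    using 2[of fst] sX by simp
  show "(\<integral>\<omega>. snd (X \<omega>) * fst (Y \<omega>) \<partial>M) = (\<integral>\<omega>. fst (X \<omega>) * snd (X \<omega>) \<partial>M)"
    using 1[of snd] sX by (simp add: mult.commute)
qed

text \<open>Conditional expectation contracts L2: expand E[(Y - X)^2] >= 0 with E[XY] = E[X^2] in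
  each coordinate. For plans this bounds the moments of x by those of the fixed marginal.\<close>

lemma barycentric_second_moments_le:
  assumes M: "prob_space M" and b: "barycentric M X Y"
  shows "(\<integral>\<omega>. (fst (X \<omega>))\<^sup>2 \<partial>M) \<le> (\<integral>\<omega>. (fst (Y \<omega>))\<^sup>2 \<partial>M)"
    and "(\<integral>\<omega>. (snd (X \<omega>))\<^sup>2 \<partial>M) \<le> (\<integral>\<omega>. (snd (Y \<omega>))\<^sup>2 \<partial>M)"
proof -
  have X [measurable]: "X \<in> borel_measurable M" and Y [measurable]: "Y \<in> borel_measurable M"
    and sX: "integrable M (\<lambda>\<omega>. (norm (X \<omega>))\<^sup>2)" and sY: "integrable M (\<lambda>\<omega>. (norm (Y \<omega>))\<^sup>2)"
    using b by (auto simp: barycentric_def)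
  note sX = square_integrable_components[OF M X sX] and sY = square_integrable_components[OF M Y sY]
  have *: "(\<integral>\<omega>. (f \<omega>)\<^sup>2 \<partial>M) \<le> (\<integral>\<omega>. (g \<omega>)\<^sup>2 \<partial>M)"
    if [measurable]: "f \<in> borel_measurable M" "g \<in> borel_measurable M"
      and i: "integrable M (\<lambda>x. (f x)\<^sup>2)" "integrable M (\<lambda>x. (g x)\<^sup>2)"
      and eq: "(\<integral>\<omega>. f \<omega> * g \<omega> \<partial>M) = (\<integral>\<omega>. (f \<omega>)\<^sup>2 \<partial>M)" for f g :: "'a \<Rightarrow> real"
  proof -
    have fg: "integrable M (\<lambda>\<omega>. f \<omega> * g \<omega>)" by (intro square_integrable_mult i) measurable
    have "0 \<le> (\<integral>\<omega>. (g \<omega> - f \<omega>)\<^sup>2 \<partial>M)" by simp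
    also have "\<dots> = (\<integral>\<omega>. (g \<omega>)\<^sup>2 - 2 * (f \<omega> * g \<omega>) + (f \<omega>)\<^sup>2 \<partial>M)"
      by (intro Bochner_Integration.integral_cong) (auto simp: power2_diff)
    also have "\<dots> = (\<integral>\<omega>. (g \<omega>)\<^sup>2 \<partial>M) - (\<integral>\<omega>. (f \<omega>)\<^sup>2 \<partial>M)" using i fg eq by simp
    finally show ?thesis by simp
  qed
  show "(\<integral>\<omega>. (fst (X \<omega>))\<^sup>2 \<partial>M) \<le> (\<integral>\<omega>. (fst (Y \<omega>))\<^sup>2 \<partial>M)"
    by (intro * sX sY barycentric_integral_mult[OF M b]) measurable
  show "(\<integral>\<omega>. (snd (X \<omega>))\<^sup>2 \<partial>M) \<le> (\<integral>\<omega>. (snd (Y \<omega>))\<^sup>2 \<partial>M)"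
    by (intro * sX sY barycentric_integral_mult[OF M b]) measurable
qed

text \<open>Both cross terms of the expanded cost equal E[X1 X2]. Since the law of Y is fixed,
  minimising the cost amounts to maximising E[X1 X2].\<close>

lemma barycentric_integral_cost:
  assumes M: "prob_space M" and b: "barycentric M X Y"
  shows "(\<integral>\<omega>. cost (X \<omega>) (Y \<omega>) \<partial>M) = (\<integral>\<omega>. fst (Y \<omega>) * snd (Y \<omega>) \<partial>M) - (\<integral>\<omega>. fst (X \<omega>) * snd (X \<omega>) \<partial>M)"
proof -
  have X [measurable]: "X \<in> borel_measurable M" and Y [measurable]: "Y \<in> borel_measurable M"
    and sX: "integrable M (\<lambda>\<omega>. (norm (X \<omega>))\<^sup>2)" and sY: "integrable M (\<lambda>\<omega>. (norm (Y \<omega>))\<^sup>2)"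
    using b by (auto simp: barycentric_def)
  note sX = square_integrable_components[OF M X sX] and sY = square_integrable_components[OF M Y sY]
  have "integrable M (\<lambda>\<omega>. fst (X \<omega>) * snd (X \<omega>))" "integrable M (\<lambda>\<omega>. fst (X \<omega>) * snd (Y \<omega>))"
    "integrable M (\<lambda>\<omega>. snd (X \<omega>) * fst (Y \<omega>))" "integrable M (\<lambda>\<omega>. fst (Y \<omega>) * snd (Y \<omega>))"
    by (intro square_integrable_mult sX sY; measurable)+
  moreover have "(\<integral>\<omega>. cost (X \<omega>) (Y \<omega>) \<partial>M) =
    (\<integral>\<omega>. fst (X \<omega>) * snd (X \<omega>) - fst (X \<omega>) * snd (Y \<omega>) - snd (X \<omega>) * fst (Y \<omega>) + fst (Y \<omega>) * snd (Y \<omega>) \<partial>M)"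
    by (intro Bochner_Integration.integral_cong) (auto simp: cost_def algebra_simps)
  ultimately show ?thesis using barycentric_integral_mult[OF M b] by simp
qed

section \<open>A continuous surjection with a Borel section\<close>

definition binary_digit :: "real \<Rightarrow> nat \<Rightarrow> real" where
  "binary_digit x k = of_int (\<lfloor>2 ^ Suc k * x\<rfloor> mod 2)"

lemma binary_digit_cases: "binary_digit x k = 0 \<or> binary_digit x k = 1"
  using mod2_eq_if[of "\<lfloor>2 ^ Suc k * x\<rfloor>"] by (auto simp: binary_digit_def)

lemma measurable_binary_digit [measurable]: "(\<lambda>x. binary_digit x k) \<in> borel_measurable borel"
  unfolding binary_digit_def by measurable

text \<open>Induction on n: a digit is the difference between a floor at one scale and twice the
  floor at the previous scale, so the partial sums telescope to the truncation of x.\<close>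

lemma binary_digit_partial_sum:
  assumes "0 \<le> x" "x < 1"
  shows "(\<Sum>k<n. binary_digit x k / 2 ^ Suc k) = of_int \<lfloor>2 ^ n * x\<rfloor> / 2 ^ n"
proof (induction n)
  case 0
  then show ?case using assms by (simp add: floor_eq_iff)
next
  case (Suc n)
  have "\<lfloor>2 ^ Suc n * x\<rfloor> div 2 = \<lfloor>2 ^ n * x\<rfloor>"
    using floor_divide_real_eq_div[of 2 "2 ^ Suc n * x"] by simp
  then have "\<lfloor>2 ^ Suc n * x\<rfloor> mod 2 = \<lfloor>2 ^ Suc n * x\<rfloor> - 2 * \<lfloor>2 ^ n * x\<rfloor>"
    by (metis minus_mult_div_eq_mod)
  then have "binary_digit x n = of_int \<lfloor>2 ^ Suc n * x\<rfloor> - 2 * of_int \<lfloor>2 ^ n * x\<rfloor>"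
    unfolding binary_digit_def by simp
  then show ?case using Suc by (simp add: field_simps)
qed

lemma binary_digit_sums:
  assumes "0 \<le> x" "x < 1"
  shows "(\<lambda>k. binary_digit x k / 2 ^ Suc k) sums x"
proof -
  have "(\<lambda>n. of_int \<lfloor>2 ^ n * x\<rfloor> / 2 ^ n) \<longlonglongrightarrow> x"
  proof (rule tendsto_sandwich)
    show "\<forall>\<^sub>F n in sequentially. x - 1 / 2 ^ n \<le> of_int \<lfloor>2 ^ n * x\<rfloor> / 2 ^ n"
    proof (intro always_eventually allI)
      fix n :: nat
      have "(2 ^ n * x - 1) / 2 ^ n \<le> of_int \<lfloor>2 ^ n * x\<rfloor> / 2 ^ n"
        by (intro divide_right_mono) (linarith, simp)
      then show "x - 1 / 2 ^ n \<le> of_int \<lfloor>2 ^ n * x\<rfloor> / 2 ^ n"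
        by (simp add: diff_divide_distrib)
    qed
    show "\<forall>\<^sub>F n in sequentially. of_int \<lfloor>2 ^ n * x\<rfloor> / 2 ^ n \<le> x"
      by (intro always_eventually allI) (simp add: field_simps)
    show "(\<lambda>n. x - 1 / 2 ^ n) \<longlonglongrightarrow> x" by real_asymp
  qed simp
  then show ?thesis
    unfolding sums_def binary_digit_partial_sum[OF assms] .
qed

text \<open>A clipped cosine of period 1 with two plateaus: it is 0 where the phase is within 1/6 of
  an integer and 1 where the phase lies in [1/3, 2/3] modulo 1. It acts as a continuous reader of
  ternary digits restricted to 0 and 1.\<close>

definition wave :: "real \<Rightarrow> real" where
  "wave t = max 0 (min 1 (1 / 2 - cos (2 * pi * t)))"

lemma ternary_ones: "(\<lambda>n. 1 / 3 ^ Suc n :: real) sums (1/2)"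
proof -
  have "(\<lambda>n. (1/3) * (1/3) ^ n :: real) sums ((1/3) * (1 / (1 - 1/3)))"
    by (intro sums_mult geometric_sums) auto
  then show ?thesis by (simp add: power_one_over field_simps)
qed

text \<open>The factor 3 separates the digits: the tail after a digit contributes at most 1/6 to the
  phase, on which the wave is constant.\<close>

lemma wave_ternary:
  fixes a :: "nat \<Rightarrow> real"
  assumes a: "\<And>n. a n = 0 \<or> a n = 1"
  shows "wave (3 ^ k * (\<Sum>n. a n / 3 ^ Suc n)) = a k"
proof -
  have a01: "0 \<le> a n" "a n \<le> 1" for n using a[of n] by auto
  have summ: "summable (\<lambda>n. a (n + j) / 3 ^ Suc n)" for j
    by (rule summable_comparison_test_ev[OF _ sums_summable[OF ternary_ones]])
      (use a01 in \<open>auto intro!: always_eventually divide_right_mono\<close>)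
  \<comment> \<open>The digits after position k, rescaled. Digits 0 and 1 sum in base 3 to at most
    1/2, and the division by 3 accounts for the position of digit k, whence the bound 1/6.\<close>
  define r where "r = (\<Sum>n. a (n + Suc k) / 3 ^ Suc n) / 3"
  have r: "0 \<le> r" "r \<le> 1/6"
  proof -
    show "0 \<le> r" unfolding r_def using a01 by (intro suminf_nonneg summ divide_nonneg_nonneg) auto
    have "(\<Sum>n. a (n + Suc k) / 3 ^ Suc n) \<le> (\<Sum>n. 1 / 3 ^ Suc n)"
      by (intro suminf_le summ sums_summable[OF ternary_ones] divide_right_mono) (use a01 in auto)
    then show "r \<le> 1/6" unfolding r_def using ternary_ones by (simp add: sums_iff)
  qed
  have "(\<Sum>n. a n / 3 ^ Suc n) = (\<Sum>n. a (n + Suc k) / 3 ^ Suc (n + Suc k)) + (\<Sum>n<Suc k. a n / 3 ^ Suc n)"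
    by (rule suminf_split_initial_segment) (use summ[of 0] in simp)
  also have "(\<Sum>n. a (n + Suc k) / 3 ^ Suc (n + Suc k)) = (\<Sum>n. (1 / 3 ^ Suc k) * (a (n + Suc k) / 3 ^ Suc n))"
    by (intro suminf_cong) (simp add: power_add field_simps)
  also have "\<dots> = (1 / 3 ^ Suc k) * (\<Sum>n. a (n + Suc k) / 3 ^ Suc n)"
    by (rule suminf_mult[OF summ])
  finally have "3 ^ k * (\<Sum>n. a n / 3 ^ Suc n) = r + 3 ^ k * (\<Sum>n<Suc k. a n / 3 ^ Suc n)"
    unfolding r_def by (simp add: field_simps)
  also have "3 ^ k * (\<Sum>n<Suc k. a n / 3 ^ Suc n) = a k / 3 + (\<Sum>n<k. a n * 3 ^ (k - Suc n))"
    unfolding sum_distrib_left sum.lessThan_Suc distrib_left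
    by (simp add: power_diff field_simps)
  finally have eq: "3 ^ k * (\<Sum>n. a n / 3 ^ Suc n) = r + a k / 3 + (\<Sum>n<k. a n * 3 ^ (k - Suc n))"
    by simp
  \<comment> \<open>The digits before position k contribute whole periods and disappear from the
    phase.\<close>
  have "(\<Sum>n<k. a n * 3 ^ (k - Suc n)) \<in> \<int>"
    by (intro Ints_sum Ints_mult) (use a in \<open>auto, metis Ints_0 Ints_1\<close>)
  then obtain N :: int where N: "(\<Sum>n<k. a n * 3 ^ (k - Suc n)) = of_int N" by (auto elim: Ints_cases)
  have "cos (2 * pi * (r + a k / 3 + of_int N)) = cos (2 * pi * (r + a k / 3) + of_int N * (2 * pi))"
    by (simp add: algebra_simps)
  also have "\<dots> = cos (2 * pi * (r + a k / 3))"
    using cos_int_2pin[of N] sin_int_2pin[of N] by (simp only: cos_add mult.commute[of "of_int N" "2*pi"] mult_zero_right mult_1_right diff_0_right)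
  finally have c: "wave (3 ^ k * (\<Sum>n. a n / 3 ^ Suc n)) = max 0 (min 1 (1 / 2 - cos (2 * pi * (r + a k / 3))))"
    unfolding wave_def eq N by simp
  \<comment> \<open>The remaining phase lies in [0, 1/6] or in [1/3, 1/2]. Both intervals lie in the
    half period on which the cosine decreases, so the endpoint nearest the other plateau
    decides.\<close>
  consider "a k = 0" | "a k = 1" using a by auto
  then show ?thesis
  proof cases
    case 1
    have "cos (pi / 3) \<le> cos (2 * pi * r)"
      using r by (intro cos_monotone_0_pi_le) (auto simp: field_simps)
    then show ?thesis unfolding c 1 by (simp add: cos_60)
  next
    case 2
    have "cos (2 * pi * (r + 1 / 3)) \<le> cos (2 * pi / 3)"
      using r by (intro cos_monotone_0_pi_le) (auto simp: field_simps)
    moreover have "cos (2 * pi / 3) = - 1 / 2" using cos_120 by (simp)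
    ultimately show ?thesis unfolding c 2 by simp
  qed
qed

definition code_digit :: "real \<times> real \<Rightarrow> nat \<Rightarrow> real" where
  "code_digit p n = binary_digit (if even n then fst p else snd p) (n div 2)"

text \<open>The interleaved bits are reused as ternary digits that are never 2. The gaps this leaves
  are what allows a continuous function to recover the digits, which is impossible from the binary
  expansion itself.\<close>

definition code :: "real \<times> real \<Rightarrow> real" where
  "code p = (\<Sum>n. code_digit p n / 3 ^ Suc n)"

text \<open>Schoenberg's curve with \<open>wave\<close> in place of his piecewise linear function:
  even ternary scales rebuild the first coordinate, odd ones the second.\<close>

definition schoenberg :: "real \<Rightarrow> real \<times> real" where
  "schoenberg t = (\<Sum>k. wave (3 ^ (2 * k) * t) / 2 ^ Suc k, \<Sum>k. wave (3 ^ Suc (2 * k) * t) / 2 ^ Suc k)"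

lemma code_digit_cases: "code_digit p n = 0 \<or> code_digit p n = 1"
  unfolding code_digit_def by (rule binary_digit_cases)

text \<open>At scale \<open>3 ^ k\<close> the wave returns digit k of the code, and the binary
  series reassembles the point. The value 1 is excluded because all its floor digits are 0.\<close>

lemma schoenberg_code:
  assumes "fst p \<in> {0..<1}" "snd p \<in> {0..<1}"
  shows "schoenberg (code p) = p"
proof -
  have w: "wave (3 ^ k * code p) = code_digit p k" for k
    unfolding code_def by (rule wave_ternary[OF code_digit_cases])
  show ?thesis
    unfolding schoenberg_def w
    using assms binary_digit_sums[of "fst p"] binary_digit_sums[of "snd p"]
    by (simp add: code_digit_def prod_eq_iff sums_iff)
qed

text \<open>Each coordinate is a uniform limit, by comparison with a geometric series, although the
  individual waves oscillate ever faster.\<close>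

lemma continuous_on_schoenberg: "continuous_on UNIV schoenberg"
proof -
  have *: "continuous_on UNIV (\<lambda>t. \<Sum>k. wave (c k * t) / 2 ^ Suc k)" for c :: "nat \<Rightarrow> real"
  proof (rule uniform_limit_theorem)
    show "uniform_limit UNIV (\<lambda>n t. \<Sum>k<n. wave (c k * t) / 2 ^ Suc k) (\<lambda>t. \<Sum>k. wave (c k * t) / 2 ^ Suc k) sequentially"
    proof (rule Weierstrass_m_test)
      show "norm (wave (c k * t) / 2 ^ Suc k) \<le> (1/2) ^ Suc k" for k t
        unfolding wave_def by (auto simp: power_one_over field_simps)
      show "summable (\<lambda>k. (1/2::real) ^ Suc k)" by (simp add: summable_geometric)
    qed
    show "\<forall>\<^sub>F n in sequentially. continuous_on UNIV (\<lambda>t. \<Sum>k<n. wave (c k * t) / 2 ^ Suc k)"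
      unfolding wave_def by (intro always_eventually allI continuous_intros) auto
  qed auto
  show ?thesis unfolding schoenberg_def by (intro continuous_intros *)
qed

lemma code_bounds: "0 \<le> code p" "code p \<le> 1/2"
proof -
  have d: "0 \<le> code_digit p n" "code_digit p n \<le> 1" for n using code_digit_cases[of p n] by auto
  have s: "summable (\<lambda>n. code_digit p n / 3 ^ Suc n)"
    by (rule summable_comparison_test_ev[OF _ sums_summable[OF ternary_ones]])
      (use d in \<open>auto intro!: always_eventually divide_right_mono\<close>)
  show "0 \<le> code p" unfolding code_def using d by (intro suminf_nonneg s divide_nonneg_nonneg) auto
  have "code p \<le> (\<Sum>n. 1 / 3 ^ Suc n)" unfolding code_def
    by (intro suminf_le s sums_summable[OF ternary_ones] divide_right_mono) (use d in auto)
  then show "code p \<le> 1/2" using ternary_ones by (simp add: sums_iff)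
qed

lemma measurable_code [measurable]: "code \<in> borel_measurable borel"
proof -
  have [measurable]: "(\<lambda>p. code_digit p n) \<in> borel_measurable borel" for n
    unfolding code_digit_def borel_prod[symmetric] by (cases "even n") simp_all
  show ?thesis unfolding code_def[abs_def] by measurable
qed

section \<open>Almost surely convergent representations\<close>

definition encode :: "real \<times> real \<Rightarrow> real" where
  "encode p = code (arctan (fst p) / pi + 1 / 2, arctan (snd p) / pi + 1 / 2)"

text \<open>Undoes the arctangent rescaling after following the curve. It is total because
  \<open>tan\<close> is total, but continuity may fail where the curve meets the boundary of the
  unit square, which stands for infinity.\<close>

definition decode :: "real \<Rightarrow> real \<times> real" where
  "decode t = (tan (pi * (fst (schoenberg t) - 1 / 2)), tan (pi * (snd (schoenberg t) - 1 / 2)))"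

lemma schoenberg_encode: "schoenberg (encode p) = (arctan (fst p) / pi + 1 / 2, arctan (snd p) / pi + 1 / 2)"
proof -
  have "arctan x / pi + 1 / 2 \<in> {0..<1}" for x
    using arctan_bounded[of x] by (simp add: field_simps)
  then show ?thesis unfolding encode_def by (subst schoenberg_code) auto
qed

lemma decode_encode [simp]: "decode (encode p) = p"
  unfolding decode_def schoenberg_encode by (simp add: tan_arctan)

lemma measurable_encode [measurable]: "encode \<in> borel_measurable borel"
proof -
  have [measurable]: "(arctan :: real \<Rightarrow> real) \<in> borel_measurable borel"
    by (intro borel_measurable_continuous_onI continuous_intros)
  have "(\<lambda>p. (arctan (fst p) / pi + 1 / 2, arctan (snd p) / pi + 1 / 2)) \<in> borel_measurable (borel :: (real \<times> real) measure)"
    by measurable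
  then show ?thesis unfolding encode_def[abs_def] by measurable
qed

lemma measurable_decode [measurable]: "decode \<in> borel_measurable borel"
proof -
  have [measurable]: "schoenberg \<in> borel_measurable borel"
    by (intro borel_measurable_continuous_onI continuous_on_schoenberg)
  have [measurable]: "(tan :: real \<Rightarrow> real) \<in> borel_measurable borel"
  proof -
    have [measurable]: "(sin :: real \<Rightarrow> real) \<in> borel_measurable borel" "(cos :: real \<Rightarrow> real) \<in> borel_measurable borel"
      by (intro borel_measurable_continuous_onI continuous_intros)+
    show ?thesis unfolding tan_def[abs_def] by measurable
  qed
  show ?thesis unfolding decode_def[abs_def] by measurable
qed

text \<open>If |x n| is at most R infinitely often, the limit angle is at most arctan R in modulus,
  hence stays off the poles of the tangent. A frequent bound suffices because the angles are already
  known to converge.\<close>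

lemma tendsto_tan_if_frequently_bounded:
  fixes x :: "nat \<Rightarrow> real"
  assumes lim: "(\<lambda>n. arctan (x n)) \<longlonglongrightarrow> w" and R: "\<exists>\<^sub>F n in sequentially. \<bar>x n\<bar> \<le> R"
  shows "x \<longlonglongrightarrow> tan w"
proof -
  have "\<bar>w\<bar> \<le> arctan R"
  proof (rule ccontr)
    assume "\<not> ?thesis"
    then have "\<forall>\<^sub>F n in sequentially. arctan R < \<bar>arctan (x n)\<bar>"
      by (intro order_tendstoD(1)[OF tendsto_rabs[OF lim]]) simp
    then have "\<forall>\<^sub>F n in sequentially. \<not> \<bar>x n\<bar> \<le> R"
    proof eventually_elim
      fix n assume "arctan R < \<bar>arctan (x n)\<bar>"
      then have "arctan R < arctan (x n) \<or> arctan R < arctan (- x n)" by (auto simp: arctan_minus)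
      then show "\<not> \<bar>x n\<bar> \<le> R" unfolding arctan_less_iff by auto
    qed
    with R show False by (simp add: frequently_def)
  qed
  then have "- (pi / 2) < w" "w < pi / 2"
    using arctan_ubound[of R] by linarith+
  then have c: "cos w \<noteq> 0" using cos_gt_zero_pi[of w] by auto
  have "(\<lambda>n. tan (arctan (x n))) \<longlonglongrightarrow> tan w" by (rule isCont_tendsto_compose[OF isCont_tan[OF c] lim])
  then show ?thesis by (simp add: tan_arctan)
qed

text \<open>Applying the continuous curve to convergent codes yields convergent arctangents of the
  points; the code itself may jump. The frequent bound keeps the limit away from the boundary of the
  square.\<close>

lemma tendsto_decode:
  assumes lim: "(\<lambda>n. encode (p n)) \<longlonglongrightarrow> t" and R: "\<exists>\<^sub>F n in sequentially. norm (p n) \<le> R"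
  shows "p \<longlonglongrightarrow> decode t"
proof -
  have "isCont schoenberg t" using continuous_on_schoenberg by (simp add: continuous_on_eq_continuous_at)
  then have s: "(\<lambda>n. schoenberg (encode (p n))) \<longlonglongrightarrow> schoenberg t"
    using lim by (rule isCont_tendsto_compose)
  have "(\<lambda>n. pi * (fst (schoenberg (encode (p n))) - 1/2)) \<longlonglongrightarrow> pi * (fst (schoenberg t) - 1/2)"
    by (intro tendsto_intros s)
  then have 1: "(\<lambda>n. fst (p n)) \<longlonglongrightarrow> tan (pi * (fst (schoenberg t) - 1/2))"
    by (intro tendsto_tan_if_frequently_bounded[where R=R] frequently_elim1[OF R])
      (auto simp: schoenberg_encode intro: order_trans[OF abs_component_le_norm(1)])
  have "(\<lambda>n. pi * (snd (schoenberg (encode (p n))) - 1/2)) \<longlonglongrightarrow> pi * (snd (schoenberg t) - 1/2)"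
    by (intro tendsto_intros s)
  then have 2: "(\<lambda>n. snd (p n)) \<longlonglongrightarrow> tan (pi * (snd (schoenberg t) - 1/2))"
    by (intro tendsto_tan_if_frequently_bounded[where R=R] frequently_elim1[OF R])
      (auto simp: schoenberg_encode intro: order_trans[OF abs_component_le_norm(2)])
  show ?thesis using tendsto_Pair[OF 1 2] by (simp add: decode_def)
qed

definition encode2 :: "(real \<times> real) \<times> (real \<times> real) \<Rightarrow> real" where
  "encode2 z = encode (encode (fst z), encode (snd z))"

definition decode2 :: "real \<Rightarrow> (real \<times> real) \<times> (real \<times> real)" where
  "decode2 t = (decode (fst (decode t)), decode (snd (decode t)))"

lemma decode2_encode2 [simp]: "decode2 (encode2 z) = z"
  by (simp add: encode2_def decode2_def)

lemma measurable_encode2 [measurable]: "encode2 \<in> borel_measurable borel"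
proof -
  have "(\<lambda>z. (encode (fst z), encode (snd z))) \<in> borel_measurable (borel :: ((real \<times> real) \<times> (real \<times> real)) measure)"
    by measurable
  then show ?thesis unfolding encode2_def[abs_def] by measurable
qed

lemma measurable_decode2 [measurable]: "decode2 \<in> borel_measurable borel"
  unfolding decode2_def[abs_def] by measurable

lemma tendsto_decode2:
  assumes lim: "(\<lambda>n. encode2 (z n)) \<longlonglongrightarrow> t" and R: "\<exists>\<^sub>F n in sequentially. norm (z n) \<le> R"
  shows "z \<longlonglongrightarrow> decode2 t"
proof -
  \<comment> \<open>The outer decoding acts on pairs of codes, which are bounded automatically; the
    hypothesis on \<open>R\<close> is spent on the two inner decodings only.\<close>
  have "norm (encode p, encode q) \<le> 1" for p q
  proof -
    have b: "norm (encode p) \<le> 1/2" for p using code_bounds by (simp add: encode_def)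
    have "norm (encode p, encode q) \<le> norm (encode p) + norm (encode q)" by (rule norm_Pair_le)
    also have "\<dots> \<le> 1" using b[of p] b[of q] by simp
    finally show ?thesis .
  qed
  then have "(\<lambda>n. (encode (fst (z n)), encode (snd (z n)))) \<longlonglongrightarrow> decode t"
    using lim unfolding encode2_def by (intro tendsto_decode[where R=1]) (auto intro: eventually_frequently)
  then have f: "(\<lambda>n. encode (fst (z n))) \<longlonglongrightarrow> fst (decode t)" and s: "(\<lambda>n. encode (snd (z n))) \<longlonglongrightarrow> snd (decode t)"
    by (auto dest: tendsto_fst tendsto_snd)
  have "(\<lambda>n. fst (z n)) \<longlonglongrightarrow> decode (fst (decode t))"
    by (intro tendsto_decode[OF f, where R=R] frequently_elim1[OF R]) (metis norm_fst_le order_trans prod.collapse)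
  moreover have "(\<lambda>n. snd (z n)) \<longlonglongrightarrow> decode (snd (decode t))"
    by (intro tendsto_decode[OF s, where R=R] frequently_elim1[OF R]) (metis norm_snd_le order_trans prod.collapse)
  ultimately show ?thesis using tendsto_Pair by (fastforce simp: decode2_def)
qed

text \<open>The bounded second moments keep the limit of the encoded points inside the range of the encoding.\<close>

lemma subsequence_AE_representation:
  fixes \<gamma> :: "nat \<Rightarrow> ((real \<times> real) \<times> (real \<times> real)) measure"
  assumes prob: "\<And>n. prob_space (\<gamma> n)" and sets: "\<And>n. sets (\<gamma> n) = sets borel"
    and int: "\<And>n. integrable (\<gamma> n) (\<lambda>z. (norm z)\<^sup>2)" and bd: "\<And>n. (\<integral>z. (norm z)\<^sup>2 \<partial>\<gamma> n) \<le> C"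
  obtains r :: "nat \<Rightarrow> nat" and \<Omega> :: "real measure" and Z Z'
  where "strict_mono r" "prob_space \<Omega>" "\<And>n. Z n \<in> borel_measurable \<Omega>" "Z' \<in> borel_measurable \<Omega>"
    "\<And>n. distr \<Omega> borel (Z n) = \<gamma> (r n)" "AE \<omega> in \<Omega>. (\<lambda>n. Z n \<omega>) \<longlonglongrightarrow> Z' \<omega>"
proof -
  define \<mu> where "\<mu> n = distr (\<gamma> n) borel encode2" for n
  have em: "encode2 \<in> borel_measurable (\<gamma> n)" for n
    using measurable_encode2 by (simp cong: measurable_cong_sets add: sets)
  have \<mu>: "real_distribution (\<mu> n)" for n
    unfolding \<mu>_def by (intro prob_space.real_distribution_distr prob em)
  \<comment> \<open>All codes lie in [0, 1/2], so one interval serves every law. Escape of mass in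
    the original space is not seen here and is excluded later by the moment bound.\<close>
  have "tight \<mu>"
    unfolding tight_def
  proof (intro conjI allI impI \<mu>)
    fix e :: real assume e: "e > 0"
    have b: "-1 < encode2 z" "encode2 z \<le> 1" for z
      using code_bounds[of "(_, _)"] unfolding encode2_def encode_def
      by (auto intro: less_le_trans[of "-1" 0] order_trans[of _ "1/2"])
    have "measure (\<mu> n) {-1<..1} = 1" for n
    proof -
      have "measure (\<mu> n) {-1<..1} = measure (\<gamma> n) (encode2 -` {-1<..1} \<inter> space (\<gamma> n))"
        unfolding \<mu>_def by (rule measure_distr[OF em]) simp
      also have "encode2 -` {-1<..1} \<inter> space (\<gamma> n) = space (\<gamma> n)"
        using b by auto
      finally show ?thesis using prob_space.prob_space[OF prob] by simp
    qed
    then show "\<exists>a b. a < b \<and> (\<forall>n. 1 - e < measure (\<mu> n) {a<..b})"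
      using e by (intro exI[of _ "-1"] exI[of _ 1]) simp
  qed
  then obtain r M where r: "strict_mono r" and M: "real_distribution M" "weak_conv_m (\<mu> \<circ> r) M"
    using tight_imp_convergent_subsubsequence[of \<mu> id] by (auto simp: strict_mono_id)
  have "\<exists>\<Omega> :: real measure. \<exists>T T'. prob_space \<Omega> \<and> (\<forall>n. T n \<in> borel_measurable \<Omega>) \<and>
      (\<forall>n. distr \<Omega> borel (T n) = (\<mu> \<circ> r) n) \<and> T' \<in> measurable \<Omega> lborel \<and> distr \<Omega> borel T' = M \<and>
      (\<forall>x\<in>space \<Omega>. (\<lambda>n. T n x) \<longlonglongrightarrow> T' x)"
    by (rule Skorohod) (use M \<mu> in \<open>auto simp: comp_def\<close>)
  then obtain \<Omega> :: "real measure" and T T' where \<Omega>: "prob_space \<Omega>" "\<And>n. T n \<in> borel_measurable \<Omega>"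
    "\<And>n. distr \<Omega> borel (T n) = \<mu> (r n)" "T' \<in> borel_measurable \<Omega>"
    "\<And>x. x \<in> space \<Omega> \<Longrightarrow> (\<lambda>n. T n x) \<longlonglongrightarrow> T' x"
    by (auto simp: comp_def) metis
  note [measurable] = \<Omega>(2,4)
  define Z where "Z n \<omega> = decode2 (T n \<omega>)" for n \<omega>
  have law: "distr \<Omega> borel (Z n) = \<gamma> (r n)" for n
  proof -
    have "distr \<Omega> borel (Z n) = distr (distr \<Omega> borel (T n)) borel decode2"
      unfolding Z_def by (subst distr_distr) (auto simp: comp_def)
    also have "\<dots> = distr (\<gamma> (r n)) borel (\<lambda>z. decode2 (encode2 z))"
      unfolding \<Omega> \<mu>_def by (subst distr_distr) (auto simp: comp_def em)
    also have "\<dots> = \<gamma> (r n)" by (simp add: distr_id2 sets)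
    finally show ?thesis .
  qed
  have Zm [measurable]: "Z n \<in> borel_measurable \<Omega>" for n unfolding Z_def by measurable
  \<comment> \<open>Skorohod's variables are only known through their laws. These are concentrated
    on the range of \<open>encode2\<close>, so almost surely \<open>T n\<close> really is the code
    of \<open>Z n\<close>.\<close>
  have enc: "AE \<omega> in \<Omega>. \<forall>n. encode2 (Z n \<omega>) = T n \<omega>"
  proof (subst AE_all_countable, intro allI)
    fix n
    have "AE t in \<mu> (r n). encode2 (decode2 t) = t"
      unfolding \<mu>_def by (subst AE_distr_iff) (auto intro: em)
    then show "AE \<omega> in \<Omega>. encode2 (Z n \<omega>) = T n \<omega>"
      unfolding \<Omega>(3)[symmetric] Z_def by (subst (asm) AE_distr_iff) auto
  qed
  have law_norm: "(\<integral>\<^sup>+ \<omega>. ennreal ((norm (Z n \<omega>))\<^sup>2) \<partial>\<Omega>) = ennreal (\<integral>z. (norm z)\<^sup>2 \<partial>\<gamma> (r n))" for n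
  proof -
    have "(\<integral>\<^sup>+ \<omega>. ennreal ((norm (Z n \<omega>))\<^sup>2) \<partial>\<Omega>) = (\<integral>\<^sup>+ z. ennreal ((norm z)\<^sup>2) \<partial>distr \<Omega> borel (Z n))"
      by (subst nn_integral_distr) auto
    then show ?thesis unfolding law by (simp add: nn_integral_eq_integral int)
  qed
  \<comment> \<open>Fatou makes the limit inferior of the squared norms finite almost surely. This
    bounds the norms for infinitely many n, which is the form of bound that
    \<open>tendsto_decode2\<close> asks for.\<close>
  have "(\<integral>\<^sup>+ \<omega>. liminf (\<lambda>n. ennreal ((norm (Z n \<omega>))\<^sup>2)) \<partial>\<Omega>) \<le> liminf (\<lambda>n. \<integral>\<^sup>+ \<omega>. ennreal ((norm (Z n \<omega>))\<^sup>2) \<partial>\<Omega>)"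
    by (rule nn_integral_liminf) measurable
  also have "\<dots> \<le> ennreal C"
    unfolding law_norm by (intro Liminf_le always_eventually allI ennreal_leI bd) simp
  finally have "(\<integral>\<^sup>+ \<omega>. liminf (\<lambda>n. ennreal ((norm (Z n \<omega>))\<^sup>2)) \<partial>\<Omega>) < \<infinity>"
    by (rule order_le_less_trans) simp
  then have "AE \<omega> in \<Omega>. liminf (\<lambda>n. ennreal ((norm (Z n \<omega>))\<^sup>2)) \<noteq> \<infinity>"
    by (intro nn_integral_PInf_AE) auto
  then have conv: "AE \<omega> in \<Omega>. (\<lambda>n. Z n \<omega>) \<longlonglongrightarrow> decode2 (T' \<omega>)"
    using enc AE_space
  proof eventually_elim
    fix \<omega> assume l: "liminf (\<lambda>n. ennreal ((norm (Z n \<omega>))\<^sup>2)) \<noteq> \<infinity>"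
      and e: "\<forall>n. encode2 (Z n \<omega>) = T n \<omega>" and "\<omega> \<in> space \<Omega>"
    have "\<exists>k::nat. \<exists>\<^sub>F n in sequentially. norm (Z n \<omega>) \<le> real k"
    proof (rule ccontr)
      assume "\<nexists>k::nat. \<exists>\<^sub>F n in sequentially. norm (Z n \<omega>) \<le> real k"
      then have ev: "\<forall>\<^sub>F n in sequentially. real k < norm (Z n \<omega>)" for k
        by (auto simp: frequently_def not_le)
      have "ennreal (real k) \<le> liminf (\<lambda>n. ennreal ((norm (Z n \<omega>))\<^sup>2))" for k
      proof (rule Liminf_bounded, use ev[of k] ev[of 1] in eventually_elim)
        fix n assume "real k < norm (Z n \<omega>)" "real 1 < norm (Z n \<omega>)"
        then show "ennreal (real k) \<le> ennreal ((norm (Z n \<omega>))\<^sup>2)"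
          by (intro ennreal_leI) (smt (verit) of_nat_1 power2_eq_square mult_le_cancel_left1)
      qed
      then have "liminf (\<lambda>n. ennreal ((norm (Z n \<omega>))\<^sup>2)) = \<infinity>"
        using ennreal_Ex_less_of_nat[of "liminf (\<lambda>n. ennreal ((norm (Z n \<omega>))\<^sup>2))"]
        by (metis ennreal_of_nat_eq_real_of_nat infinity_ennreal_def leD top.not_eq_extremum)
      with l show False by simp
    qed
    then obtain k where "\<exists>\<^sub>F n in sequentially. norm (Z n \<omega>) \<le> real k" ..
    then show "(\<lambda>n. Z n \<omega>) \<longlonglongrightarrow> decode2 (T' \<omega>)"
      using \<Omega>(5)[OF \<open>\<omega> \<in> space \<Omega>\<close>] e by (intro tendsto_decode2) auto
  qed
  show ?thesis
    by (rule that[OF r \<Omega>(1) Zm _ law conv]) measurable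
qed

section \<open>Sequential compactness of the set of plans\<close>

text \<open>For continuous f the integrals of f(X n) form a constant sequence, so X' and
  \<open>X 0\<close> have the same integrals against such f, hence the same law.\<close>

lemma distr_eq_if_AE_tendsto:
  fixes X :: "nat \<Rightarrow> 'a \<Rightarrow> 'b::metric_space"
  assumes "prob_space M" and [measurable]: "\<And>n. X n \<in> borel_measurable M" "X' \<in> borel_measurable M"
    and lim: "AE x in M. (\<lambda>n. X n x) \<longlonglongrightarrow> X' x" and law: "\<And>n. distr M borel (X n) = N"
  shows "distr M borel X' = N"
proof -
  interpret prob_space M by fact
  have ind: "(\<integral>x. indicator A (X' x) * 1 \<partial>M) = (\<integral>x. indicator A (X 0 x) * (1::real) \<partial>M)" if A: "A \<in> sets borel" for A
  proof (rule integral_indicator_eq_if_continuous_eq[OF _ _ _ _ _ A])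
    fix f :: "'b \<Rightarrow> real" assume f: "continuous_on UNIV f" "\<And>y. 0 \<le> f y" "\<And>y. f y \<le> 1"
    have [measurable]: "f \<in> borel_measurable borel" using f(1) by (rule borel_measurable_continuous_onI)
    have "(\<lambda>n. \<integral>x. f (X n x) * 1 \<partial>M) \<longlonglongrightarrow> (\<integral>x. f (X' x) * 1 \<partial>M)"
      by (rule integral_continuous_mult_tendsto[where C=1, OF _ _ _ _ _ _ _ lim f]) (auto simp: prob_space)
    moreover have "(\<lambda>n. \<integral>x. f (X n x) * 1 \<partial>M) = (\<lambda>_. \<integral>x. f (X 0 x) * 1 \<partial>M)"
    proof
      fix n show "(\<integral>x. f (X n x) * 1 \<partial>M) = (\<integral>x. f (X 0 x) * 1 \<partial>M)"
      using integral_distr[of "X n" M borel f] integral_distr[of "X 0" M borel f] by (simp add: law)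
    qed
    ultimately show "(\<integral>x. f (X' x) * 1 \<partial>M) = (\<integral>x. f (X 0 x) * 1 \<partial>M)"
      using LIMSEQ_unique[OF _ tendsto_const] by metis
  qed auto
  have "measure M (X' -` A \<inter> space M) = measure M (X 0 -` A \<inter> space M)" if A: "A \<in> sets borel" for A
  proof -
    have "(\<integral>x. indicator A (Z x) * (1::real) \<partial>M) = measure M (Z -` A \<inter> space M)" if "Z \<in> borel_measurable M" for Z
    proof -
      have "(\<integral>x. indicator A (Z x) * (1::real) \<partial>M) = (\<integral>x. indicator (Z -` A \<inter> space M) x \<partial>M)"
        by (intro Bochner_Integration.integral_cong) (auto simp: indicator_def)
      then show ?thesis by simp
    qed
    then show ?thesis using ind[OF A] by simp
  qed
  then have "distr M borel X' = distr M borel (X 0)"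
    by (intro measure_eqI) (auto simp: emeasure_distr emeasure_eq_measure)
  then show ?thesis by (simp add: law)
qed

text \<open>Indicators of Borel sets do not pass to the limit, since the law of X' may charge their
  boundaries. The condition is first extended to continuous bounded test functions of
  \<open>X n\<close>, passed to the limit there, and then returned to indicators.\<close>

lemma barycentric_AE_limit:
  fixes X Y :: "nat \<Rightarrow> 'a \<Rightarrow> real \<times> real"
  assumes M: "prob_space M" and b: "\<And>n. barycentric M (X n) (Y n)"
    and [measurable]: "X' \<in> borel_measurable M" "Y' \<in> borel_measurable M"
    and limX: "AE x in M. (\<lambda>n. X n x) \<longlonglongrightarrow> X' x" and limY: "AE x in M. (\<lambda>n. Y n x) \<longlonglongrightarrow> Y' x"
    and C: "\<And>n. (\<integral>x. (fst (Y n x))\<^sup>2 \<partial>M) \<le> C" "\<And>n. (\<integral>x. (snd (Y n x))\<^sup>2 \<partial>M) \<le> C"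
  shows "barycentric M X' Y'"
proof -
  interpret prob_space M by fact
  have [measurable]: "\<And>n. X n \<in> borel_measurable M" "\<And>n. Y n \<in> borel_measurable M"
    and sX: "\<And>n. integrable M (\<lambda>\<omega>. (norm (X n \<omega>))\<^sup>2)" and sY: "\<And>n. integrable M (\<lambda>\<omega>. (norm (Y n \<omega>))\<^sup>2)"
    using b by (auto simp: barycentric_def)
  have sX: "\<And>n. integrable M (\<lambda>\<omega>. (fst (X n \<omega>))\<^sup>2)" "\<And>n. integrable M (\<lambda>\<omega>. (snd (X n \<omega>))\<^sup>2)"
    and sY: "\<And>n. integrable M (\<lambda>\<omega>. (fst (Y n \<omega>))\<^sup>2)" "\<And>n. integrable M (\<lambda>\<omega>. (snd (Y n \<omega>))\<^sup>2)"
    and iX: "\<And>n. integrable M (\<lambda>\<omega>. fst (X n \<omega>))" "\<And>n. integrable M (\<lambda>\<omega>. snd (X n \<omega>))"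
    and iY: "\<And>n. integrable M (\<lambda>\<omega>. fst (Y n \<omega>))" "\<And>n. integrable M (\<lambda>\<omega>. snd (Y n \<omega>))"
    using square_integrable_components[OF M _ sX] square_integrable_components[OF M _ sY]
      integrable_components[OF M _ sX] integrable_components[OF M _ sY] by auto
  have CX: "(\<integral>x. (fst (X n x))\<^sup>2 \<partial>M) \<le> C" "(\<integral>x. (snd (X n x))\<^sup>2 \<partial>M) \<le> C" for n
    using barycentric_second_moments_le[OF M b[of n]] C[of n] by linarith+
  have lims: "AE x in M. (\<lambda>n. fst (X n x)) \<longlonglongrightarrow> fst (X' x)" "AE x in M. (\<lambda>n. snd (X n x)) \<longlonglongrightarrow> snd (X' x)"
    "AE x in M. (\<lambda>n. fst (Y n x)) \<longlonglongrightarrow> fst (Y' x)" "AE x in M. (\<lambda>n. snd (Y n x)) \<longlonglongrightarrow> snd (Y' x)"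
    using limX limY by (eventually_elim, auto intro: tendsto_fst tendsto_snd)+
  have sq: "integrable M (\<lambda>x. (fst (X' x))\<^sup>2)" "integrable M (\<lambda>x. (snd (X' x))\<^sup>2)"
    "integrable M (\<lambda>x. (fst (Y' x))\<^sup>2)" "integrable M (\<lambda>x. (snd (Y' x))\<^sup>2)"
    by (rule square_integrable_AE_limit(1)[OF _ _ sX(1) CX(1) lims(1)] square_integrable_AE_limit(1)[OF _ _ sX(2) CX(2) lims(2)]
      square_integrable_AE_limit(1)[OF _ _ sY(1) C(1) lims(3)] square_integrable_AE_limit(1)[OF _ _ sY(2) C(2) lims(4)]; measurable)+
  have int: "integrable M (\<lambda>x. fst (X' x))" "integrable M (\<lambda>x. snd (X' x))"
    "integrable M (\<lambda>x. fst (Y' x))" "integrable M (\<lambda>x. snd (Y' x))"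
    using sq by (auto intro!: square_integrable_imp_integrable)
  \<comment> \<open>To be used with p a coordinate of Y and q the same coordinate of X.\<close>
  have lim_eq: "(\<integral>x. f (X' x) * p' x \<partial>M) = (\<integral>x. f (X' x) * q' x \<partial>M)"
    if f: "continuous_on UNIV f" "\<And>y. 0 \<le> f y" "\<And>y. f y \<le> 1"
      and [measurable]: "\<And>n. p n \<in> borel_measurable M" "p' \<in> borel_measurable M" "\<And>n. q n \<in> borel_measurable M" "q' \<in> borel_measurable M"
      and p: "\<And>n. integrable M (\<lambda>x. (p n x)\<^sup>2)" "\<And>n. (\<integral>x. (p n x)\<^sup>2 \<partial>M) \<le> C" "AE x in M. (\<lambda>n. p n x) \<longlonglongrightarrow> p' x"
      and q: "\<And>n. integrable M (\<lambda>x. (q n x)\<^sup>2)" "\<And>n. (\<integral>x. (q n x)\<^sup>2 \<partial>M) \<le> C" "AE x in M. (\<lambda>n. q n x) \<longlonglongrightarrow> q' x"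
      and eq: "\<And>n. (\<integral>x. f (X n x) * p n x \<partial>M) = (\<integral>x. f (X n x) * q n x \<partial>M)"
    for f :: "real \<times> real \<Rightarrow> real" and p q :: "nat \<Rightarrow> 'a \<Rightarrow> real" and p' q'
  proof (rule LIMSEQ_unique)
    show "(\<lambda>n. \<integral>x. f (X n x) * p n x \<partial>M) \<longlonglongrightarrow> (\<integral>x. f (X' x) * p' x \<partial>M)"
      by (rule integral_continuous_mult_tendsto[OF _ _ _ _ p limX f]) measurable
    show "(\<lambda>n. \<integral>x. f (X n x) * p n x \<partial>M) \<longlonglongrightarrow> (\<integral>x. f (X' x) * q' x \<partial>M)"
      unfolding eq by (rule integral_continuous_mult_tendsto[OF _ _ _ _ q limX f]) measurable
  qed
  have cont_eq: "(\<integral>x. f (X n x) * fst (Y n x) \<partial>M) = (\<integral>x. f (X n x) * fst (X n x) \<partial>M)"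
    "(\<integral>x. f (X n x) * snd (Y n x) \<partial>M) = (\<integral>x. f (X n x) * snd (X n x) \<partial>M)"
    if f: "continuous_on UNIV f" "\<And>y. 0 \<le> f y" "\<And>y. f y \<le> 1" for f :: "real \<times> real \<Rightarrow> real" and n
  proof -
    have [measurable]: "f \<in> borel_measurable borel" using f(1) by (rule borel_measurable_continuous_onI)
    have i: "integrable M (\<lambda>x. f (X n x) * u x)" if u: "integrable M u" for u
      by (rule Bochner_Integration.integrable_bound[OF u]) (use u f in \<open>auto simp: abs_mult mult_left_le_one_le\<close>)
    show "(\<integral>x. f (X n x) * fst (Y n x) \<partial>M) = (\<integral>x. f (X n x) * fst (X n x) \<partial>M)"
      by (rule integral_mult_if_indicator_eq[where g=fst and h=f, OF M _ _ _ iY(1) iX(1) _ i[OF iY(1)]])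
        (use b[of n] in \<open>auto simp: barycentric_def\<close>)
    show "(\<integral>x. f (X n x) * snd (Y n x) \<partial>M) = (\<integral>x. f (X n x) * snd (X n x) \<partial>M)"
      by (rule integral_mult_if_indicator_eq[where g=snd and h=f, OF M _ _ _ iY(2) iX(2) _ i[OF iY(2)]])
        (use b[of n] in \<open>auto simp: barycentric_def\<close>)
  qed
  have "(\<integral>x. indicator A (X' x) * fst (Y' x) \<partial>M) = (\<integral>x. indicator A (X' x) * fst (X' x) \<partial>M)" if A: "A \<in> sets borel" for A
  proof (rule integral_indicator_eq_if_continuous_eq[OF _ _ int(3) int(1) _ A])
    fix f :: "real \<times> real \<Rightarrow> real" assume f: "continuous_on UNIV f" "\<And>y. 0 \<le> f y" "\<And>y. f y \<le> 1"
    show "(\<integral>x. f (X' x) * fst (Y' x) \<partial>M) = (\<integral>x. f (X' x) * fst (X' x) \<partial>M)"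
      by (rule lim_eq[OF f _ _ _ _ sY(1) C(1) lims(3) sX(1) CX(1) lims(1) cont_eq(1)[OF f]]) measurable
  qed measurable
  moreover have "(\<integral>x. indicator A (X' x) * snd (Y' x) \<partial>M) = (\<integral>x. indicator A (X' x) * snd (X' x) \<partial>M)" if A: "A \<in> sets borel" for A
  proof (rule integral_indicator_eq_if_continuous_eq[OF _ _ int(4) int(2) _ A])
    fix f :: "real \<times> real \<Rightarrow> real" assume f: "continuous_on UNIV f" "\<And>y. 0 \<le> f y" "\<And>y. f y \<le> 1"
    show "(\<integral>x. f (X' x) * snd (Y' x) \<partial>M) = (\<integral>x. f (X' x) * snd (X' x) \<partial>M)"
      by (rule lim_eq[OF f _ _ _ _ sY(2) C(2) lims(4) sX(2) CX(2) lims(2) cont_eq(2)[OF f]]) measurable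
  qed measurable
  ultimately show ?thesis
    unfolding barycentric_def using sq by (simp add: integrable_norm_sq_prod_iff)
qed

lemma integral_cost_distr_Pair:
  assumes [measurable]: "X \<in> borel_measurable \<Omega>" "Y \<in> borel_measurable \<Omega>"
  shows "(\<integral>z. cost (fst z) (snd z) \<partial>distr \<Omega> borel (\<lambda>\<omega>. (X \<omega>, Y \<omega>))) = (\<integral>\<omega>. cost (X \<omega>) (Y \<omega>) \<partial>\<Omega>)"
  by (subst integral_distr) (auto simp: cost_def)

lemma Gamma_sequentially_compact:
  assumes G: "\<And>n. \<gamma> n \<in> Gamma \<nu>"
  obtains \<gamma>' and r :: "nat \<Rightarrow> nat" where "\<gamma>' \<in> Gamma \<nu>" "strict_mono r"
    "(\<lambda>n. \<integral>z. cost (fst z) (snd z) \<partial>\<gamma> (r n)) \<longlonglongrightarrow> (\<integral>z. cost (fst z) (snd z) \<partial>\<gamma>')"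
proof -
  have P: "prob_space (\<gamma> n)" and S: "sets (\<gamma> n) = sets borel" and law: "distr (\<gamma> n) borel snd = \<nu>"
    and b: "barycentric (\<gamma> n) fst snd" for n
    using G Gamma_iff_barycentric by auto
  note proj [measurable] = borel_measurable_proj[OF S]
  have mom: "(\<integral>z. f (snd z) \<partial>\<gamma> n) = (\<integral>y. f y \<partial>\<nu>)" if "f \<in> borel_measurable borel" for n and f :: "real \<times> real \<Rightarrow> real"
    using integral_distr[OF proj(2) that, of n] by (simp add: law)
  have int: "integrable (\<gamma> n) (\<lambda>z. (norm z)\<^sup>2)" for n using G by (simp add: Gamma_def)
  \<comment> \<open>The total second moment of the marginal. By contraction that of x is no larger,
    so every plan has second moment at most \<open>2 * C\<close>.\<close>
  define C where "C = (\<integral>y. (fst y)\<^sup>2 \<partial>\<nu>) + (\<integral>y. (snd y)\<^sup>2 \<partial>\<nu>)"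
  have C: "(\<integral>y. (fst y)\<^sup>2 \<partial>\<nu>) \<le> C" "(\<integral>y. (snd y)\<^sup>2 \<partial>\<nu>) \<le> C" unfolding C_def by auto
  have bd: "(\<integral>z. (norm z)\<^sup>2 \<partial>\<gamma> n) \<le> 2 * C" for n
  proof -
    have "integrable (\<gamma> n) (\<lambda>z. (norm (fst z))\<^sup>2)" "integrable (\<gamma> n) (\<lambda>z. (norm (snd z))\<^sup>2)"
      using b[of n] by (auto simp: barycentric_def)
    note s = square_integrable_components[OF P proj(1) this(1)] square_integrable_components[OF P proj(2) this(2)]
    have "(\<integral>z. (norm z)\<^sup>2 \<partial>\<gamma> n) = (\<integral>z. (fst (fst z))\<^sup>2 + (snd (fst z))\<^sup>2 + ((fst (snd z))\<^sup>2 + (snd (snd z))\<^sup>2) \<partial>\<gamma> n)"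
      by (simp add: norm_sq_prod)
    also have "\<dots> = (\<integral>z. (fst (fst z))\<^sup>2 \<partial>\<gamma> n) + (\<integral>z. (snd (fst z))\<^sup>2 \<partial>\<gamma> n) + ((\<integral>z. (fst (snd z))\<^sup>2 \<partial>\<gamma> n) + (\<integral>z. (snd (snd z))\<^sup>2 \<partial>\<gamma> n))"
      using s by simp
    also have "\<dots> \<le> 2 * C"
      using barycentric_second_moments_le[OF P b[of n]] mom[of "\<lambda>y. (fst y)\<^sup>2" n] mom[of "\<lambda>y. (snd y)\<^sup>2" n] by (simp add: C_def)
    finally show ?thesis .
  qed
  obtain r :: "nat \<Rightarrow> nat" and \<Omega> :: "real measure" and Z Z'
    where r: "strict_mono r" and \<Omega>: "prob_space \<Omega>" and Zm: "\<And>n. Z n \<in> borel_measurable \<Omega>" "Z' \<in> borel_measurable \<Omega>"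
    and Zlaw: "\<And>n. distr \<Omega> borel (Z n) = \<gamma> (r n)" and lim: "AE \<omega> in \<Omega>. (\<lambda>n. Z n \<omega>) \<longlonglongrightarrow> Z' \<omega>"
    by (rule subsequence_AE_representation[OF P S int bd]) (rule that; assumption)
  note [measurable] = Zm
  define X where "X n \<omega> = fst (Z n \<omega>)" for n \<omega>
  define Y where "Y n \<omega> = snd (Z n \<omega>)" for n \<omega>
  define X' where "X' \<omega> = fst (Z' \<omega>)" for \<omega>
  define Y' where "Y' \<omega> = snd (Z' \<omega>)" for \<omega>
  have XY [measurable]: "X n \<in> borel_measurable \<Omega>" "Y n \<in> borel_measurable \<Omega>" "X' \<in> borel_measurable \<Omega>" "Y' \<in> borel_measurable \<Omega>" for n
    unfolding X_def Y_def X'_def Y'_def by measurable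
  have limX: "AE \<omega> in \<Omega>. (\<lambda>n. X n \<omega>) \<longlonglongrightarrow> X' \<omega>" and limY: "AE \<omega> in \<Omega>. (\<lambda>n. Y n \<omega>) \<longlonglongrightarrow> Y' \<omega>"
    using lim unfolding X_def Y_def X'_def Y'_def by (eventually_elim, auto intro: tendsto_fst tendsto_snd)+
  have "distr \<Omega> borel (\<lambda>\<omega>. (X n \<omega>, Y n \<omega>)) = \<gamma> (r n)" for n
    unfolding X_def Y_def by (simp add: Zlaw)
  then have Ylaw: "distr \<Omega> borel (Y n) = \<nu>" and bn: "barycentric \<Omega> (X n) (Y n)"
    and cost_n: "(\<integral>z. cost (fst z) (snd z) \<partial>\<gamma> (r n)) = (\<integral>\<omega>. cost (X n \<omega>) (Y n \<omega>) \<partial>\<Omega>)" for n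
    using distr_Pair_in_Gamma_iff[OF \<Omega>, of "X n" "Y n" \<nu>] integral_cost_distr_Pair[of "X n" \<Omega> "Y n"] G[of "r n"] by auto
  have Y'law: "distr \<Omega> borel Y' = \<nu>"
    by (rule distr_eq_if_AE_tendsto[OF \<Omega> _ _ limY Ylaw]) measurable
  have momY: "(\<integral>\<omega>. f (Y n \<omega>) \<partial>\<Omega>) = (\<integral>y. f y \<partial>\<nu>)" "(\<integral>\<omega>. f (Y' \<omega>) \<partial>\<Omega>) = (\<integral>y. f y \<partial>\<nu>)"
    if [measurable]: "f \<in> borel_measurable borel" for n and f :: "real \<times> real \<Rightarrow> real"
    using integral_distr[of "Y n" \<Omega> borel f] integral_distr[of Y' \<Omega> borel f] by (simp_all add: Ylaw Y'law)
  have b': "barycentric \<Omega> X' Y'"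
    by (rule barycentric_AE_limit[where C=C, OF \<Omega> bn _ _ limX limY])
      (use C in \<open>simp_all add: momY(1)[of "\<lambda>y. (fst y)\<^sup>2"] momY(1)[of "\<lambda>y. (snd y)\<^sup>2"]\<close>)
  have s: "integrable \<Omega> (\<lambda>\<omega>. (fst (X n \<omega>))\<^sup>2)" "integrable \<Omega> (\<lambda>\<omega>. (snd (Y n \<omega>))\<^sup>2)" for n
    using bn[of n] square_integrable_components[OF \<Omega>] by (auto simp: barycentric_def)
  have s': "integrable \<Omega> (\<lambda>\<omega>. (snd (Y' \<omega>))\<^sup>2)" "integrable \<Omega> (\<lambda>\<omega>. snd (Y' \<omega>))"
    using b' square_integrable_components[OF \<Omega>] integrable_components[OF \<Omega>] by (auto simp: barycentric_def)
  have lims: "AE x in \<Omega>. (\<lambda>n. fst (X n x)) \<longlonglongrightarrow> fst (X' x)" "AE x in \<Omega>. (\<lambda>n. snd (Y n x)) \<longlonglongrightarrow> snd (Y' x)"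
    using limX limY by (eventually_elim, auto intro: tendsto_fst tendsto_snd)+
  \<comment> \<open>All \<open>Y n\<close> and Y' have the law \<nu>, so the second moments are
    constant and almost sure convergence upgrades to L2.\<close>
  have "(\<lambda>n. \<integral>\<omega>. (snd (Y n \<omega>) - snd (Y' \<omega>))\<^sup>2 \<partial>\<Omega>) \<longlonglongrightarrow> 0"
    by (rule L2_convergence_if_AE_and_norms[OF _ _ s(2) s'(1) lims(2)])
      (simp_all add: momY[of "\<lambda>y. (snd y)\<^sup>2"])
  moreover have "(\<integral>\<omega>. (fst (X n \<omega>))\<^sup>2 \<partial>\<Omega>) \<le> C" for n
    using barycentric_second_moments_le(1)[OF \<Omega> bn[of n]] C(1) momY(1)[of "\<lambda>y. (fst y)\<^sup>2" n] by simp
  ultimately have "(\<lambda>n. \<integral>\<omega>. fst (X n \<omega>) * snd (Y n \<omega>) \<partial>\<Omega>) \<longlonglongrightarrow> (\<integral>\<omega>. fst (X' \<omega>) * snd (Y' \<omega>) \<partial>\<Omega>)"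
    by (intro integral_mult_tendsto_weak_strong[OF _ _ _ _ s(1) _ lims(1) s(2) s']) auto
  then have "(\<lambda>n. (\<integral>y. fst y * snd y \<partial>\<nu>) - (\<integral>\<omega>. fst (X n \<omega>) * snd (X n \<omega>) \<partial>\<Omega>)) \<longlonglongrightarrow>
      (\<integral>y. fst y * snd y \<partial>\<nu>) - (\<integral>\<omega>. fst (X' \<omega>) * snd (X' \<omega>) \<partial>\<Omega>)"
    unfolding barycentric_integral_mult(3)[OF \<Omega> bn] barycentric_integral_mult(3)[OF \<Omega> b'] by (intro tendsto_intros)
  then have "(\<lambda>n. \<integral>z. cost (fst z) (snd z) \<partial>\<gamma> (r n)) \<longlonglongrightarrow> (\<integral>\<omega>. cost (X' \<omega>) (Y' \<omega>) \<partial>\<Omega>)"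
    unfolding cost_n barycentric_integral_cost[OF \<Omega> bn] barycentric_integral_cost[OF \<Omega> b']
    by (simp add: momY[of "\<lambda>y. fst y * snd y"])
  then show ?thesis
    using that[of "distr \<Omega> borel (\<lambda>\<omega>. (X' \<omega>, Y' \<omega>))" r] r b' Y'law integral_cost_distr_Pair[of X' \<Omega> Y']
      distr_Pair_in_Gamma_iff[OF \<Omega>, of X' Y' \<nu>] by simp
qed

section \<open>Finite labels\<close>

text \<open>The law of the code of y restricted to B has a continuous distribution function, which
  by the intermediate value theorem takes the value w at some t; the piece consists of the points of
  B with code at most t.\<close>

lemma atomless_subset_of_measure:
  fixes \<nu> :: "(real \<times> real) measure"
  assumes "finite_measure \<nu>" and S [measurable_cong]: "sets \<nu> = sets borel" and atomless: "\<And>y. emeasure \<nu> {y} = 0"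
    and B [measurable]: "B \<in> sets borel" and w: "0 \<le> w" "w \<le> measure \<nu> B"
  obtains A where "A \<in> sets borel" "A \<subseteq> B" "measure \<nu> A = w"
proof -
  interpret finite_measure \<nu> by fact
  define G where "G = distr (density \<nu> (indicator B)) borel encode"
  have enc [measurable]: "encode \<in> borel_measurable \<nu>"
    using measurable_encode by (simp cong: measurable_cong_sets)
  have spc: "space \<nu> = UNIV" using sets_eq_imp_space_eq[OF S] by simp
  have em: "emeasure G D = emeasure \<nu> (B \<inter> encode -` D)" if [measurable]: "D \<in> sets borel" for D
  proof -
    have D: "encode -` D \<in> sets \<nu>" using measurable_sets[OF enc that] by (simp add: spc)
    have "emeasure G D = emeasure (density \<nu> (indicator B)) (encode -` D)"
      unfolding G_def by (subst emeasure_distr) (auto simp: spc)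
    also have "\<dots> = (\<integral>\<^sup>+ x. indicator B x * indicator (encode -` D) x \<partial>\<nu>)"
      using D by (subst emeasure_density) auto
    also have "\<dots> = (\<integral>\<^sup>+ x. indicator (B \<inter> encode -` D) x \<partial>\<nu>)"
      by (intro nn_integral_cong) (auto simp: indicator_def)
    also have "\<dots> = emeasure \<nu> (B \<inter> encode -` D)" using D B S by (intro nn_integral_indicator) auto
    finally show ?thesis .
  qed
  have G: "sets G = sets borel" "space G = UNIV" by (simp_all add: G_def)
  have "finite_measure G" by (rule finite_measureI) (simp add: em[of UNIV] G)
  then interpret G: finite_borel_measure G
    by (intro finite_borel_measure.intro finite_borel_measure_axioms.intro G)
  \<comment> \<open>By injectivity of the code, at most one point of the plane has code t, and
    single points are null.\<close>
  have "emeasure G {t} = 0" for t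
  proof -
    have "y = decode t" if "encode y = t" for y using decode_encode[of y] that by simp
    then have "B \<inter> encode -` {t} \<subseteq> {decode t}" by blast
    then have "emeasure \<nu> (B \<inter> encode -` {t}) \<le> emeasure \<nu> {decode t}" by (intro emeasure_mono) (auto simp: S)
    then show ?thesis by (simp add: em atomless)
  qed
  then have cont: "isCont (cdf G) t" for t by (simp add: G.isCont_cdf measure_def)
  have cdf: "cdf G t = measure \<nu> (B \<inter> encode -` {..t})" for t
    by (simp add: cdf_def measure_def em)
  have total: "measure G (space G) = measure \<nu> B"
    by (simp add: measure_def em[of UNIV] G)
  \<comment> \<open>The limits of the distribution function at the two infinities need strict
    inequalities to provide points on either side of w.\<close>
  consider "w = 0" | "w = measure \<nu> B" | "0 < w" "w < measure \<nu> B" using w by linarith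
  then show ?thesis
  proof cases
    case 1
    then show ?thesis using that[of "{}"] by simp
  next
    case 2
    then show ?thesis using that[of B] by simp
  next
    case 3
    have "\<forall>\<^sub>F t in at_bot. cdf G t < w" using G.cdf_lim_at_bot 3 by (auto dest: order_tendstoD(2))
    then obtain a where a: "cdf G a < w" using eventually_happens'[OF trivial_limit_at_bot_linorder] by blast
    have "\<forall>\<^sub>F t in at_top. w < cdf G t" using G.cdf_lim_at_top 3 unfolding total by (auto dest: order_tendstoD(1))
    then obtain b where b: "w < cdf G b" using eventually_happens'[OF trivial_limit_at_top_linorder] by blast
    have "a \<le> b" using a b G.cdf_nondecreasing[of b a] by linarith
    then obtain t where "cdf G t = w" using IVT[of "cdf G" a w b] a b cont by auto
    moreover have "B \<inter> encode -` {..t} \<in> sets borel" using measurable_sets[OF measurable_encode, of "{..t}"] by simp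
    ultimately show ?thesis using that[of "B \<inter> encode -` {..t}"] by (simp add: cdf)
  qed
qed

text \<open>Induction on the set of labels: a piece of mass \<open>w v\<close> is cut off for one
  label and the remainder of B is shared among the others.\<close>

lemma atomless_finite_partition:
  fixes \<nu> :: "(real \<times> real) measure" and w :: "'l \<Rightarrow> real"
  assumes \<nu>: "finite_measure \<nu>" "sets \<nu> = sets borel" "\<And>y. emeasure \<nu> {y} = 0"
    and V: "finite V" "V \<noteq> {}" and B: "B \<in> sets borel"
    and w: "\<And>v. v \<in> V \<Longrightarrow> 0 \<le> w v" "(\<Sum>v\<in>V. w v) = measure \<nu> B"
  shows "\<exists>L. L \<in> measurable borel (count_space UNIV) \<and> range L \<subseteq> V \<and> (\<forall>v\<in>V. measure \<nu> (B \<inter> L -` {v}) = w v)"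
  using V B w
proof (induction V arbitrary: B rule: finite_ne_induct)
  case (singleton v)
  then show ?case by (intro exI[of _ "\<lambda>_. v"]) auto
next
  case (insert v V)
  interpret finite_measure \<nu> by fact
  have "0 \<le> (\<Sum>u\<in>V. w u)" using insert.prems by (intro sum_nonneg) auto
  then have "0 \<le> w v" "w v \<le> measure \<nu> B" using insert.prems insert.hyps by auto
  then obtain A where A: "A \<in> sets borel" "A \<subseteq> B" "measure \<nu> A = w v"
    using atomless_subset_of_measure[OF \<nu> insert.prems(1)] by metis
  have "(\<Sum>u\<in>V. w u) = measure \<nu> (B - A)"
    using insert.prems insert.hyps A \<nu>(2) by (subst finite_measure_Diff) auto
  then obtain L where L: "L \<in> measurable borel (count_space UNIV)" "range L \<subseteq> V" "\<And>u. u \<in> V \<Longrightarrow> measure \<nu> ((B - A) \<inter> L -` {u}) = w u"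
    using insert.IH[of "B - A"] insert.prems A by auto
  note [measurable] = L(1) A(1)
  define L' where "L' y = (if y \<in> A then v else L y)" for y
  have "L' \<in> measurable borel (count_space UNIV)" unfolding L'_def by measurable
  moreover have "range L' \<subseteq> insert v V" using L(2) by (auto simp: L'_def)
  moreover have "measure \<nu> (B \<inter> L' -` {u}) = w u" if "u \<in> insert v V" for u
  proof (cases "u = v")
    case True
    have "L y \<noteq> v" for y using L(2) insert.hyps by blast
    then have "L' y = u \<longleftrightarrow> y \<in> A" for y using True by (simp add: L'_def)
    then have "B \<inter> L' -` {u} = A" using A(2) by auto
    then show ?thesis using A True by simp
  next
    case False
    then have "B \<inter> L' -` {u} = (B - A) \<inter> L -` {u}" by (auto simp: L'_def)
    then show ?thesis using L(3)[of u] False that by simp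
  qed
  ultimately show ?case by (intro exI[of _ L']) blast
qed

text \<open>Each cell t = b has the same mass as the event T = b, so it can be cut according to the
  masses of S within that event. Gluing these labels over the cells reproduces the joint law of (S,
  T) exactly, with both variables now functions of y.\<close>

lemma atomless_joint_law:
  fixes \<nu> :: "(real \<times> real) measure" and S :: "'p \<Rightarrow> 'l" and T :: "'p \<Rightarrow> 'k"
  assumes \<nu>: "finite_measure \<nu>" "sets \<nu> = sets borel" "\<And>y. emeasure \<nu> {y} = 0"
    and P: "prob_space P" and S [measurable]: "S \<in> measurable P (count_space UNIV)" and T [measurable]: "T \<in> measurable P (count_space UNIV)"
    and finS: "finite (range S)"
    and t: "t \<in> measurable borel (count_space UNIV)" "finite (range t)"
    and law: "\<And>b. measure \<nu> (t -` {b}) = measure P (T -` {b} \<inter> space P)"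
  obtains L where "L \<in> measurable borel (count_space UNIV)" "range L \<subseteq> range S"
    "\<And>v b. v \<in> range S \<Longrightarrow> b \<in> range t \<Longrightarrow> measure \<nu> (t -` {b} \<inter> L -` {v}) = measure P (S -` {v} \<inter> T -` {b} \<inter> space P)"
proof -
  interpret P: prob_space P by fact
  have "\<exists>L. L \<in> measurable borel (count_space UNIV) \<and> range L \<subseteq> range S \<and>
      (\<forall>v\<in>range S. measure \<nu> (t -` {b} \<inter> L -` {v}) = measure P (S -` {v} \<inter> T -` {b} \<inter> space P))" for b
  proof (rule atomless_finite_partition[OF \<nu> finS])
    show "t -` {b} \<in> sets borel" using measurable_sets[OF t(1), of "{b}"] by simp
    have "S -` {v} \<inter> T -` {b} \<inter> space P = (S -` {v} \<inter> space P) \<inter> (T -` {b} \<inter> space P)" for v by auto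
    then have [measurable]: "S -` {v} \<inter> T -` {b} \<inter> space P \<in> sets P" for v
      using measurable_sets[OF S, of "{v}"] measurable_sets[OF T, of "{b}"] by (simp add: sets.Int)
    have "(\<Sum>v\<in>range S. measure P (S -` {v} \<inter> T -` {b} \<inter> space P)) = measure P (\<Union>v\<in>range S. S -` {v} \<inter> T -` {b} \<inter> space P)"
      by (intro P.finite_measure_finite_Union[symmetric] finS) (auto simp: disjoint_family_on_def)
    also have "(\<Union>v\<in>range S. S -` {v} \<inter> T -` {b} \<inter> space P) = T -` {b} \<inter> space P" by auto
    finally show "(\<Sum>v\<in>range S. measure P (S -` {v} \<inter> T -` {b} \<inter> space P)) = measure \<nu> (t -` {b})"
      by (simp add: law)
  qed auto
  then obtain L where L: "\<And>b. L b \<in> measurable borel (count_space UNIV)" "\<And>b. range (L b) \<subseteq> range S"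
      "\<And>b v. v \<in> range S \<Longrightarrow> measure \<nu> (t -` {b} \<inter> L b -` {v}) = measure P (S -` {v} \<inter> T -` {b} \<inter> space P)"
    by metis
  show ?thesis
  proof (rule that[of "\<lambda>y. L (t y) y"])
    have "t -` {b} \<in> sets borel" for b using measurable_sets[OF t(1), of "{b}"] by simp
    then have "t \<in> measurable borel (count_space (range t))"
      by (subst measurable_count_space_eq2[OF t(2)]) simp
    then show "(\<lambda>y. L (t y) y) \<in> measurable borel (count_space UNIV)"
      by (rule measurable_compose_countable'[where I="range t" and f=L, OF L(1) _ countable_finite[OF t(2)]])
    show "range (\<lambda>y. L (t y) y) \<subseteq> range S" using L(2) by blast
    fix v b assume "v \<in> range S"
    have "t -` {b} \<inter> (\<lambda>y. L (t y) y) -` {v} = t -` {b} \<inter> L b -` {v}" by auto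
    then show "measure \<nu> (t -` {b} \<inter> (\<lambda>y. L (t y) y) -` {v}) = measure P (S -` {v} \<inter> T -` {b} \<inter> space P)"
      using L(3)[OF \<open>v \<in> range S\<close>] by simp
  qed
qed

text \<open>The elementary conditional mean given a discrete label. On a null cell division by zero
  gives 0, which is harmless since the cell has no weight.\<close>

definition label_mean :: "'a measure \<Rightarrow> ('a \<Rightarrow> 'l) \<Rightarrow> ('a \<Rightarrow> real) \<Rightarrow> 'l \<Rightarrow> real" where
  "label_mean M L f v = (\<integral>\<omega>. indicator {v} (L \<omega>) * f \<omega> \<partial>M) / (\<integral>\<omega>. indicator {v} (L \<omega>) \<partial>M)"

lemma integral_finite_label:
  fixes f :: "'a \<Rightarrow> real" and h :: "'l \<Rightarrow> real"
  assumes [measurable]: "L \<in> measurable M (count_space UNIV)" and fin: "finite R" "range L \<subseteq> R" and f: "integrable M f"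
  shows "integrable M (\<lambda>\<omega>. h (L \<omega>) * f \<omega>)"
    and "(\<integral>\<omega>. h (L \<omega>) * f \<omega> \<partial>M) = (\<Sum>v\<in>R. h v * (\<integral>\<omega>. indicator {v} (L \<omega>) * f \<omega> \<partial>M))"
proof -
  have [measurable]: "f \<in> borel_measurable M" using f by auto
  have i: "integrable M (\<lambda>\<omega>. indicator {v} (L \<omega>) * f \<omega>)" for v
    by (rule Bochner_Integration.integrable_bound[OF f]) (auto simp: indicator_def)
  have eq: "h (L \<omega>) * f \<omega> = (\<Sum>v\<in>R. h v * (indicator {v} (L \<omega>) * f \<omega>))" for \<omega>
  proof -
    have "(\<Sum>v\<in>R. h v * (indicator {v} (L \<omega>) * f \<omega>)) = (\<Sum>v\<in>{L \<omega>}. h v * (indicator {v} (L \<omega>) * f \<omega>))"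
      using fin by (intro sum.mono_neutral_right) (auto simp: indicator_def)
    then show ?thesis by simp
  qed
  show "integrable M (\<lambda>\<omega>. h (L \<omega>) * f \<omega>)" unfolding eq using i by auto
  show "(\<integral>\<omega>. h (L \<omega>) * f \<omega> \<partial>M) = (\<Sum>v\<in>R. h v * (\<integral>\<omega>. indicator {v} (L \<omega>) * f \<omega> \<partial>M))"
    unfolding eq using i by (subst Bochner_Integration.integral_sum) auto
qed

context
  fixes M :: "'a measure" and L :: "'a \<Rightarrow> 'l"
  assumes M: "prob_space M" and L [measurable]: "L \<in> measurable M (count_space UNIV)" and fin: "finite (range L)"
begin

interpretation prob_space M by (fact M)

lemma measurable_label: "(\<lambda>\<omega>. h (L \<omega>)) \<in> borel_measurable M" for h :: "'l \<Rightarrow> 'b::topological_space"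
  by (rule measurable_compose[OF L]) simp

lemma integrable_label: "integrable M (\<lambda>\<omega>. h (L \<omega>) :: real)"
  using integral_finite_label(1)[OF L fin subset_refl, of "\<lambda>_. 1" h] by simp

text \<open>On a null cell both sides are 0, so the identity holds for every label value without a
  positivity condition.\<close>

lemma label_mean_mult_measure:
  assumes f: "integrable M f"
  shows "label_mean M L f v * (\<integral>\<omega>. indicator {v} (L \<omega>) \<partial>M) = (\<integral>\<omega>. indicator {v} (L \<omega>) * f \<omega> \<partial>M)"
proof (cases "(\<integral>\<omega>. indicator {v} (L \<omega>) \<partial>M) = (0::real)")
  case True
  then have "AE \<omega> in M. indicator {v} (L \<omega>) = (0::real)"
    by (subst (asm) integral_nonneg_eq_0_iff_AE) (auto intro: integrable_label)
  then have "AE \<omega> in M. indicator {v} (L \<omega>) * f \<omega> = 0" by eventually_elim simp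
  then have "(\<integral>\<omega>. indicator {v} (L \<omega>) * f \<omega> \<partial>M) = 0"
    by (rule integral_eq_zero_AE)
  then show ?thesis using True by simp
next
  case False
  then show ?thesis by (simp add: label_mean_def)
qed

lemma integral_label_mean:
  assumes f: "integrable M f"
  shows "(\<integral>\<omega>. h (L \<omega>) * label_mean M L f (L \<omega>) \<partial>M) = (\<integral>\<omega>. h (L \<omega>) * f \<omega> \<partial>M)"
proof -
  have "(\<integral>\<omega>. (h (L \<omega>) * label_mean M L f (L \<omega>)) * 1 \<partial>M) =
      (\<Sum>v\<in>range L. (h v * label_mean M L f v) * (\<integral>\<omega>. indicator {v} (L \<omega>) * 1 \<partial>M))"
    by (rule integral_finite_label(2)[OF L fin subset_refl]) simp
  also have "\<dots> = (\<Sum>v\<in>range L. h v * (\<integral>\<omega>. indicator {v} (L \<omega>) * f \<omega> \<partial>M))"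
    using label_mean_mult_measure[OF f] by (simp add: mult.assoc)
  also have "\<dots> = (\<integral>\<omega>. h (L \<omega>) * f \<omega> \<partial>M)"
    by (rule integral_finite_label(2)[OF L fin subset_refl f, symmetric])
  finally show ?thesis by simp
qed

text \<open>Events determined by the conditional mean are unions of label cells, and on each cell
  the mean has the same integral as Y. Every finite label thus yields an exactly admissible
  pair.\<close>

lemma barycentric_label_mean:
  assumes [measurable]: "Y \<in> borel_measurable M" and sY: "integrable M (\<lambda>\<omega>. (norm (Y \<omega>))\<^sup>2)"
  shows "barycentric M (\<lambda>\<omega>. (label_mean M L (\<lambda>\<omega>. fst (Y \<omega>)) (L \<omega>), label_mean M L (\<lambda>\<omega>. snd (Y \<omega>)) (L \<omega>))) Y"
proof -
  note i = integrable_components[OF M assms]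
  have "integrable M (\<lambda>\<omega>. (norm (label_mean M L (\<lambda>\<omega>. fst (Y \<omega>)) (L \<omega>), label_mean M L (\<lambda>\<omega>. snd (Y \<omega>)) (L \<omega>)))\<^sup>2)"
    by (rule integrable_label[of "\<lambda>l. (norm (label_mean M L (\<lambda>\<omega>. fst (Y \<omega>)) l, label_mean M L (\<lambda>\<omega>. snd (Y \<omega>)) l))\<^sup>2"])
  moreover have "(\<lambda>\<omega>. (label_mean M L (\<lambda>\<omega>. fst (Y \<omega>)) (L \<omega>), label_mean M L (\<lambda>\<omega>. snd (Y \<omega>)) (L \<omega>))) \<in> borel_measurable M"
    by (rule measurable_label[of "\<lambda>l. (label_mean M L (\<lambda>\<omega>. fst (Y \<omega>)) l, label_mean M L (\<lambda>\<omega>. snd (Y \<omega>)) l)"])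
  ultimately show ?thesis
    unfolding barycentric_def using assms
      integral_label_mean[OF i(1), of "\<lambda>l. indicator _ (label_mean M L (\<lambda>\<omega>. fst (Y \<omega>)) l, label_mean M L (\<lambda>\<omega>. snd (Y \<omega>)) l)"]
      integral_label_mean[OF i(2), of "\<lambda>l. indicator _ (label_mean M L (\<lambda>\<omega>. fst (Y \<omega>)) l, label_mean M L (\<lambda>\<omega>. snd (Y \<omega>)) l)"]
    by simp
qed

text \<open>Pythagoras: f minus its label mean is orthogonal to every function of the label.\<close>

lemma label_mean_best_approximation:
  assumes [measurable]: "f \<in> borel_measurable M" and f: "integrable M (\<lambda>\<omega>. (f \<omega>)\<^sup>2)"
  shows "(\<integral>\<omega>. (label_mean M L f (L \<omega>) - f \<omega>)\<^sup>2 \<partial>M) \<le> (\<integral>\<omega>. (f \<omega> - s (L \<omega>))\<^sup>2 \<partial>M)"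
proof -
  have i: "integrable M f" by (rule square_integrable_imp_integrable[OF _ f]) measurable
  define g where "g = label_mean M L f"
  define d where "d v = g v - s v" for v
  note [measurable] = measurable_label[of g] measurable_label[of d]
  have sq: "integrable M (\<lambda>\<omega>. (h (L \<omega>))\<^sup>2)" for h :: "'l \<Rightarrow> real" using integrable_label[of "\<lambda>l. (h l)\<^sup>2"] .
  have "integrable M (\<lambda>\<omega>. (g (L \<omega>) - f \<omega>)\<^sup>2)" by (intro square_integrable_diff sq f) measurable
  moreover have i2: "integrable M (\<lambda>\<omega>. d (L \<omega>) * g (L \<omega>))" "integrable M (\<lambda>\<omega>. d (L \<omega>) * f \<omega>)"
    by (intro square_integrable_mult sq f; measurable)+
  moreover have "(\<integral>\<omega>. d (L \<omega>) * g (L \<omega>) \<partial>M) = (\<integral>\<omega>. d (L \<omega>) * f \<omega> \<partial>M)"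
    unfolding g_def by (rule integral_label_mean[OF i])
  moreover have "(\<integral>\<omega>. (f \<omega> - s (L \<omega>))\<^sup>2 \<partial>M) = (\<integral>\<omega>. (g (L \<omega>) - f \<omega>)\<^sup>2 - 2 * (d (L \<omega>) * g (L \<omega>) - d (L \<omega>) * f \<omega>) + (d (L \<omega>))\<^sup>2 \<partial>M)"
    by (intro Bochner_Integration.integral_cong) (auto simp: d_def power2_eq_square algebra_simps)
  ultimately have "(\<integral>\<omega>. (f \<omega> - s (L \<omega>))\<^sup>2 \<partial>M) = (\<integral>\<omega>. (g (L \<omega>) - f \<omega>)\<^sup>2 \<partial>M) + (\<integral>\<omega>. (d (L \<omega>))\<^sup>2 \<partial>M)"
    using sq[of d] by simp
  moreover have "0 \<le> (\<integral>\<omega>. (d (L \<omega>))\<^sup>2 \<partial>M)" by simp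
  ultimately show ?thesis unfolding g_def by linarith
qed

text \<open>The conditional mean of X and X form a barycentric pair, so the loss in the expected
  product is exactly the expected \<open>cost\<close> between them. By
  \<open>a * b \<le> a\<^sup>2 + b\<^sup>2\<close> it is at most a squared L2 distance, and the
  conditional mean is at least as close to X as any \<open>s (L)\<close>.\<close>

lemma label_mean_product_loss:
  assumes X [measurable]: "X \<in> borel_measurable M" and sX: "integrable M (\<lambda>\<omega>. (norm (X \<omega>))\<^sup>2)"
  shows "(\<integral>\<omega>. fst (X \<omega>) * snd (X \<omega>) \<partial>M) \<le>
    (\<integral>\<omega>. label_mean M L (\<lambda>\<omega>. fst (X \<omega>)) (L \<omega>) * label_mean M L (\<lambda>\<omega>. snd (X \<omega>)) (L \<omega>) \<partial>M)
    + (\<integral>\<omega>. (norm (X \<omega> - s (L \<omega>)))\<^sup>2 \<partial>M)"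
proof -
  let ?f = "label_mean M L (\<lambda>\<omega>. fst (X \<omega>))" and ?g = "label_mean M L (\<lambda>\<omega>. snd (X \<omega>))"
  note sq = square_integrable_components[OF M X sX]
  note [measurable] = measurable_label[of ?f] measurable_label[of ?g] measurable_label[of "\<lambda>l. fst (s l)"] measurable_label[of "\<lambda>l. snd (s l)"]
  have lsq: "integrable M (\<lambda>\<omega>. (h (L \<omega>))\<^sup>2)" for h :: "'l \<Rightarrow> real" using integrable_label[of "\<lambda>l. (h l)\<^sup>2"] .
  have d: "integrable M (\<lambda>\<omega>. (?f (L \<omega>) - fst (X \<omega>))\<^sup>2)" "integrable M (\<lambda>\<omega>. (?g (L \<omega>) - snd (X \<omega>))\<^sup>2)"
    "integrable M (\<lambda>\<omega>. (fst (X \<omega>) - fst (s (L \<omega>)))\<^sup>2)" "integrable M (\<lambda>\<omega>. (snd (X \<omega>) - snd (s (L \<omega>)))\<^sup>2)"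
    using lsq[of "\<lambda>l. fst (s l)"] lsq[of "\<lambda>l. snd (s l)"] by (auto intro!: square_integrable_diff lsq sq)
  have "(\<integral>\<omega>. fst (X \<omega>) * snd (X \<omega>) \<partial>M) - (\<integral>\<omega>. ?f (L \<omega>) * ?g (L \<omega>) \<partial>M) = (\<integral>\<omega>. cost (?f (L \<omega>), ?g (L \<omega>)) (X \<omega>) \<partial>M)"
    using barycentric_integral_cost[OF M barycentric_label_mean[OF X sX]] by simp
  also have "\<dots> \<le> (\<integral>\<omega>. (?f (L \<omega>) - fst (X \<omega>))\<^sup>2 + (?g (L \<omega>) - snd (X \<omega>))\<^sup>2 \<partial>M)"
  proof (rule integral_mono)
    show "integrable M (\<lambda>\<omega>. cost (?f (L \<omega>), ?g (L \<omega>)) (X \<omega>))"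
      unfolding cost_def fst_conv snd_conv by (intro square_integrable_mult d) measurable
    fix \<omega>
    have "a * b \<le> a\<^sup>2 + b\<^sup>2" for a b :: real
      using sum_squares_bound[of a b] zero_le_power2[of a] zero_le_power2[of b] zero_le_power2[of "a + b"] by (simp add: power2_sum)
    then show "cost (?f (L \<omega>), ?g (L \<omega>)) (X \<omega>) \<le> (?f (L \<omega>) - fst (X \<omega>))\<^sup>2 + (?g (L \<omega>) - snd (X \<omega>))\<^sup>2"
      by (simp add: cost_def)
  qed (use d in auto)
  also have "\<dots> = (\<integral>\<omega>. (?f (L \<omega>) - fst (X \<omega>))\<^sup>2 \<partial>M) + (\<integral>\<omega>. (?g (L \<omega>) - snd (X \<omega>))\<^sup>2 \<partial>M)"
    using d by simp
  also have "\<dots> \<le> (\<integral>\<omega>. (fst (X \<omega>) - fst (s (L \<omega>)))\<^sup>2 \<partial>M) + (\<integral>\<omega>. (snd (X \<omega>) - snd (s (L \<omega>)))\<^sup>2 \<partial>M)"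
    by (intro add_mono label_mean_best_approximation[of _ "\<lambda>l. fst (s l)"] label_mean_best_approximation[of _ "\<lambda>l. snd (s l)"] sq) measurable
  also have "\<dots> = (\<integral>\<omega>. (norm (X \<omega> - s (L \<omega>)))\<^sup>2 \<partial>M)" using d by (simp add: norm_sq_prod)
  finally show ?thesis by simp
qed

end

section \<open>Approximation of plans by maps\<close>

lemma simple_approximation_of_identity:
  obtains s :: "nat \<Rightarrow> real \<times> real \<Rightarrow> real \<times> real"
  where "\<And>k. s k \<in> measurable borel (count_space UNIV)" "\<And>k. finite (range (s k))"
    "\<And>x. (\<lambda>k. s k x) \<longlonglongrightarrow> x" "\<And>k x. norm (s k x) \<le> 2 * norm x"
proof -
  have "(\<lambda>x. x) \<in> borel_measurable (borel :: (real \<times> real) measure)" by simp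
  from borel_measurable_implies_sequence_metric[OF this, of 0]
  obtain s :: "nat \<Rightarrow> real \<times> real \<Rightarrow> real \<times> real" where s: "\<forall>k. simple_function borel (s k)"
    "\<forall>x\<in>space borel. (\<lambda>k. s k x) \<longlonglongrightarrow> x" "\<forall>k. \<forall>x\<in>space borel. dist (s k x) 0 \<le> 2 * dist x 0"
    by blast
  show ?thesis
  proof (rule that[of s])
    show "s k \<in> measurable borel (count_space UNIV)" for k using s(1) by (simp add: measurable_simple_function)
    show "finite (range (s k))" for k using simple_functionD(1)[of borel "s k"] s(1) by simp
    show "(\<lambda>k. s k x) \<longlonglongrightarrow> x" for x using s(2) by (simp only: space_borel UNIV_I ball_UNIV)
    show "norm (s k x) \<le> 2 * norm x" for k x using s(3) by (simp only: space_borel ball_UNIV dist_0_norm dist_commute[of _ 0])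
  qed
qed

text \<open>The bound \<open>norm (s k x) \<le> 2 * norm x\<close> makes the error at most three
  times the norm, giving a dominating function. The exponent p = 2 serves for x and p = 1 for
  y.\<close>

lemma simple_approximation_tendsto:
  fixes s :: "nat \<Rightarrow> real \<times> real \<Rightarrow> real \<times> real"
  assumes [measurable]: "X \<in> borel_measurable M" and s [measurable]: "\<And>k. s k \<in> borel_measurable borel"
    and lim: "\<And>x. (\<lambda>k. s k x) \<longlonglongrightarrow> x" and bd: "\<And>k x. norm (s k x) \<le> 2 * norm x"
    and p: "integrable M (\<lambda>\<omega>. norm (X \<omega>) ^ p)" "p > 0"
  shows "(\<lambda>k. \<integral>\<omega>. norm (X \<omega> - s k (X \<omega>)) ^ p \<partial>M) \<longlonglongrightarrow> 0"
    and "integrable M (\<lambda>\<omega>. norm (X \<omega> - s k (X \<omega>)) ^ p)"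
proof -
  have [measurable]: "(\<lambda>\<omega>. s k (X \<omega>)) \<in> borel_measurable M" for k
    by (rule measurable_compose[OF assms(1) s])
  have b: "norm (norm (X \<omega> - s k (X \<omega>)) ^ p) \<le> 3 ^ p * norm (X \<omega>) ^ p" for k \<omega>
  proof -
    have "norm (X \<omega> - s k (X \<omega>)) \<le> 3 * norm (X \<omega>)"
      using norm_triangle_ineq4[of "X \<omega>" "s k (X \<omega>)"] bd[of k "X \<omega>"] by linarith
    then show ?thesis using power_mono[of "norm (X \<omega> - s k (X \<omega>))" "3 * norm (X \<omega>)" p] by (simp add: power_mult_distrib)
  qed
  have "(\<lambda>k. \<integral>\<omega>. norm (X \<omega> - s k (X \<omega>)) ^ p \<partial>M) \<longlonglongrightarrow> (\<integral>\<omega>. 0 \<partial>M)"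
  proof (rule integral_dominated_convergence[where w="\<lambda>\<omega>. 3 ^ p * norm (X \<omega>) ^ p"])
    have "(\<lambda>k. norm (x - s k x) ^ p) \<longlonglongrightarrow> norm (x - x) ^ p" for x
      by (intro tendsto_intros lim)
    then show "AE \<omega> in M. (\<lambda>k. norm (X \<omega> - s k (X \<omega>)) ^ p) \<longlonglongrightarrow> 0"
      using p(2) by (simp add: power_0_left)
  qed (use b p in auto)
  then show "(\<lambda>k. \<integral>\<omega>. norm (X \<omega> - s k (X \<omega>)) ^ p \<partial>M) \<longlonglongrightarrow> 0" by simp
  show "integrable M (\<lambda>\<omega>. norm (X \<omega> - s k (X \<omega>)) ^ p)"
    by (rule Bochner_Integration.integrable_bound[where f="\<lambda>\<omega>. 3 ^ p * norm (X \<omega>) ^ p"]) (use b p in auto)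
qed

text \<open>Since \<open>c\<close> is 1-Lipschitz, discretising its argument costs at most the L1
  error, whatever the label cell. The space Q is left general so that the estimate applies both to
  \<nu> with Z the identity and to the space carrying the original label.\<close>

lemma label_integral_simple_approximation:
  fixes K :: "'q \<Rightarrow> 'l" and t :: "real \<times> real \<Rightarrow> real \<times> real"
  assumes Q: "prob_space Q" and K [measurable]: "K \<in> measurable Q (count_space UNIV)"
    and Z [measurable]: "Z \<in> borel_measurable Q" and law: "distr Q borel Z = \<nu>"
    and t: "t \<in> measurable borel (count_space UNIV)" "finite (range t)"
    and c: "c \<in> borel_measurable borel" "\<And>x y. \<bar>c x - c y\<bar> \<le> norm (x - y)"
    and int: "integrable \<nu> c" "integrable \<nu> (\<lambda>y. norm (y - t y))"
  shows "\<bar>(\<integral>\<omega>. indicator {v} (K \<omega>) * c (Z \<omega>) \<partial>Q) - (\<integral>\<omega>. c (t (Z \<omega>)) * indicator {v} (K \<omega>) \<partial>Q)\<bar>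
    \<le> (\<integral>y. norm (y - t y) \<partial>\<nu>)"
proof -
  interpret prob_space Q by fact
  have [measurable]: "t \<in> borel_measurable borel"
    using measurable_compose[OF t(1), of "\<lambda>y. y" borel] by auto
  note [measurable] = c(1)
  have i: "integrable Q (\<lambda>\<omega>. c (Z \<omega>))" "integrable Q (\<lambda>\<omega>. norm (Z \<omega> - t (Z \<omega>)))"
    using int integrable_distr_eq[of Z Q borel c] integrable_distr_eq[of Z Q borel "\<lambda>y. norm (y - t y)"] by (simp_all add: law)
  have tZ: "(\<lambda>z. t (Z z)) \<in> measurable Q (count_space UNIV)" by (rule measurable_compose[OF Z t(1)])
  have "integrable Q (\<lambda>\<omega>. indicator {v} (K \<omega>) :: real)"
    by (rule integrable_const_bound[of _ 1]) (auto simp: indicator_def)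
  then have i2: "integrable Q (\<lambda>\<omega>. c (t (Z \<omega>)) * indicator {v} (K \<omega>))"
    by (intro integral_finite_label(1)[OF tZ t(2)]) auto
  have i1: "integrable Q (\<lambda>\<omega>. indicator {v} (K \<omega>) * c (Z \<omega>))"
    by (rule Bochner_Integration.integrable_bound[OF i(1)]) (auto simp: indicator_def)
  have "\<bar>(\<integral>\<omega>. indicator {v} (K \<omega>) * c (Z \<omega>) \<partial>Q) - (\<integral>\<omega>. c (t (Z \<omega>)) * indicator {v} (K \<omega>) \<partial>Q)\<bar> =
      \<bar>\<integral>\<omega>. indicator {v} (K \<omega>) * c (Z \<omega>) - c (t (Z \<omega>)) * indicator {v} (K \<omega>) \<partial>Q\<bar>" using i1 i2 by simp
  also have "\<dots> \<le> (\<integral>\<omega>. \<bar>indicator {v} (K \<omega>) * c (Z \<omega>) - c (t (Z \<omega>)) * indicator {v} (K \<omega>)\<bar> \<partial>Q)"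
    by (rule integral_abs_bound)
  also have "\<dots> \<le> (\<integral>\<omega>. norm (Z \<omega> - t (Z \<omega>)) \<partial>Q)"
    by (rule integral_mono) (use i i1 i2 c(2) in \<open>auto simp: indicator_def\<close>)
  also have "\<dots> = (\<integral>y. norm (y - t y) \<partial>\<nu>)"
    unfolding law[symmetric] by (rule integral_distr[symmetric]) measurable
  finally show ?thesis .
qed

text \<open>After discretisation the two integrals coincide, because they depend only on the joint
  law of the label and t(y). The factor 2 counts one discretisation error on each side.\<close>

lemma label_integral_close:
  fixes \<nu> :: "(real \<times> real) measure" and t :: "real \<times> real \<Rightarrow> real \<times> real" and S :: "'p \<Rightarrow> 'l"
  assumes \<nu>: "prob_space \<nu>" "sets \<nu> = sets borel"
    and P: "prob_space P" and Y [measurable]: "Y \<in> borel_measurable P" and law: "distr P borel Y = \<nu>"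
    and t: "t \<in> measurable borel (count_space UNIV)" "finite (range t)"
    and L: "L \<in> measurable borel (count_space UNIV)" and S: "S \<in> measurable P (count_space UNIV)"
    and joint: "\<And>b. b \<in> range t \<Longrightarrow> measure \<nu> (t -` {b} \<inter> L -` {v}) = measure P (S -` {v} \<inter> (\<lambda>z. t (Y z)) -` {b} \<inter> space P)"
    and c: "c \<in> borel_measurable borel" "\<And>x y :: real \<times> real. \<bar>c x - c y\<bar> \<le> norm (x - y)"
    and int: "integrable \<nu> c" "integrable \<nu> (\<lambda>y. norm (y - t y))"
  shows "\<bar>(\<integral>y. indicator {v} (L y) * c y \<partial>\<nu>) - (\<integral>z. indicator {v} (S z) * c (Y z) \<partial>P)\<bar> \<le> 2 * (\<integral>y. norm (y - t y) \<partial>\<nu>)"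
    and "(\<integral>y. indicator {v} (L y) \<partial>\<nu>) = (\<integral>z. indicator {v} (S z) \<partial>P :: real)"
proof -
  interpret \<nu>: prob_space \<nu> by fact
  interpret P: prob_space P by fact
  note [measurable_cong] = \<nu>(2)
  have spc: "space \<nu> = UNIV" using sets_eq_imp_space_eq[OF \<nu>(2)] by simp
  have tn: "t \<in> measurable \<nu> (count_space UNIV)" using t(1) \<nu>(2) by (simp cong: measurable_cong_sets)
  have Ln [measurable]: "L \<in> measurable \<nu> (count_space UNIV)" using L \<nu>(2) by (simp cong: measurable_cong_sets)
  have tY: "(\<lambda>z. t (Y z)) \<in> measurable P (count_space UNIV)" by (rule measurable_compose[OF Y t(1)])
  note [measurable] = S
  have tb: "(\<lambda>y. y) \<in> borel_measurable \<nu>" using \<nu>(2) by (simp cong: measurable_cong_sets)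
  have iL: "integrable \<nu> (\<lambda>y. indicator {v} (L y) :: real)"
    by (rule \<nu>.integrable_const_bound[of _ 1]) (auto simp: indicator_def)
  have iS: "integrable P (\<lambda>z. indicator {v} (S z) :: real)"
    by (rule P.integrable_const_bound[of _ 1]) (auto simp: indicator_def)
  have eq: "(\<integral>y. h (t y) * indicator {v} (L y) \<partial>\<nu>) = (\<integral>z. h (t (Y z)) * indicator {v} (S z) \<partial>P)" for h :: "real \<times> real \<Rightarrow> real"
  proof -
    have "(\<integral>y. h (t y) * indicator {v} (L y) \<partial>\<nu>) = (\<Sum>b\<in>range t. h b * (\<integral>y. indicator {b} (t y) * indicator {v} (L y) \<partial>\<nu>))"
      by (rule integral_finite_label(2)[OF tn t(2) subset_refl iL])
    also have "\<dots> = (\<Sum>b\<in>range t. h b * (\<integral>z. indicator {b} (t (Y z)) * indicator {v} (S z) \<partial>P))"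
    proof (intro sum.cong refl arg_cong2[where f="(*)"])
      fix b assume b: "b \<in> range t"
      have "(\<integral>y. indicator {b} (t y) * indicator {v} (L y) \<partial>\<nu>) = (\<integral>y. indicator (t -` {b} \<inter> L -` {v}) y \<partial>\<nu> :: real)"
        by (intro Bochner_Integration.integral_cong) (auto simp: indicator_def)
      also have "\<dots> = measure \<nu> (t -` {b} \<inter> L -` {v})" by (simp add: spc)
      also have "\<dots> = measure P (S -` {v} \<inter> (\<lambda>z. t (Y z)) -` {b} \<inter> space P)" by (rule joint[OF b])
      also have "\<dots> = (\<integral>z. indicator (S -` {v} \<inter> (\<lambda>z. t (Y z)) -` {b} \<inter> space P) z \<partial>P)" by simp
      also have "\<dots> = (\<integral>z. indicator {b} (t (Y z)) * indicator {v} (S z) \<partial>P)"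
        by (intro Bochner_Integration.integral_cong) (auto simp: indicator_def)
      finally show "(\<integral>y. indicator {b} (t y) * indicator {v} (L y) \<partial>\<nu>) = (\<integral>z. indicator {b} (t (Y z)) * indicator {v} (S z) \<partial>P :: real)" .
    qed
    also have "\<dots> = (\<integral>z. h (t (Y z)) * indicator {v} (S z) \<partial>P)"
      by (rule integral_finite_label(2)[OF tY t(2) _ iS, symmetric]) auto
    finally show ?thesis .
  qed
  show "(\<integral>y. indicator {v} (L y) \<partial>\<nu>) = (\<integral>z. indicator {v} (S z) \<partial>P :: real)"
    using eq[of "\<lambda>_. 1"] by simp
  have "distr \<nu> borel (\<lambda>y. y) = \<nu>" by (rule distr_id2) (simp add: \<nu>(2))
  then show "\<bar>(\<integral>y. indicator {v} (L y) * c y \<partial>\<nu>) - (\<integral>z. indicator {v} (S z) * c (Y z) \<partial>P)\<bar> \<le> 2 * (\<integral>y. norm (y - t y) \<partial>\<nu>)"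
    using label_integral_simple_approximation[OF \<nu>(1) Ln _ _ t c int, of "\<lambda>y. y" v]
      label_integral_simple_approximation[OF P S Y law t c int, of v] eq[of c] tb by auto
qed

text \<open>Two errors of e / 2 are allowed: one for averaging x over finitely many cells, one for
  replacing the barycentres of these cells by those of the imitating label.\<close>

lemma Gamma_approximation_by_maps:
  assumes atomless: "\<And>y. emeasure \<nu> {y} = 0" and \<gamma>: "\<gamma> \<in> Gamma \<nu>" and e: "0 < e"
  obtains T where "T \<in> borel_measurable borel" "barycentric \<nu> T (\<lambda>y. y)"
    "(\<integral>z. fst (fst z) * snd (fst z) \<partial>\<gamma>) \<le> (\<integral>y. fst (T y) * snd (T y) \<partial>\<nu>) + e"
proof -
  have P: "prob_space \<gamma>" and S: "sets \<gamma> = sets borel" and law: "distr \<gamma> borel snd = \<nu>" and b: "barycentric \<gamma> fst snd"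
    using \<gamma> Gamma_iff_barycentric by auto
  note proj [measurable] = borel_measurable_proj[OF S]
  have \<nu>: "prob_space \<nu>" "sets \<nu> = sets borel"
    unfolding law[symmetric] using prob_space.prob_space_distr[OF P proj(2)] by auto
  have fin\<nu>: "finite_measure \<nu>" using \<nu>(1) by (simp add: prob_space_def)
  note [measurable_cong] = \<nu>(2)
  have sqx: "integrable \<gamma> (\<lambda>z. (norm (fst z))\<^sup>2)" and sqy: "integrable \<gamma> (\<lambda>z. (norm (snd z))\<^sup>2)"
    using b by (auto simp: barycentric_def)
  have sq\<nu>: "integrable \<nu> (\<lambda>y. (norm y)\<^sup>2)"
    unfolding law[symmetric] by (subst integrable_distr_eq) (use sqy in auto)
  have id: "(\<lambda>y. y) \<in> borel_measurable \<nu>" using \<nu>(2) by (simp cong: measurable_cong_sets)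
  note i\<nu> = integrable_components[OF \<nu>(1) id sq\<nu>]
  note ix = integrable_components[OF P proj(1) sqx] and iy = integrable_components[OF P proj(2) sqy]
  obtain s :: "nat \<Rightarrow> real \<times> real \<Rightarrow> real \<times> real"
    where s: "\<And>k. s k \<in> measurable borel (count_space UNIV)" "\<And>k. finite (range (s k))"
      "\<And>x. (\<lambda>k. s k x) \<longlonglongrightarrow> x" "\<And>k x. norm (s k x) \<le> 2 * norm x"
    by (rule simple_approximation_of_identity) (rule that; assumption)
  have sb [measurable]: "s k \<in> borel_measurable borel" for k
    using measurable_compose[OF s(1)[of k], of "\<lambda>y. y" borel] by simp
  have "(\<lambda>k. \<integral>z. norm (fst z - s k (fst z)) ^ 2 \<partial>\<gamma>) \<longlonglongrightarrow> 0"
    by (rule simple_approximation_tendsto[OF proj(1) sb s(3,4) sqx]) simp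
  then have "\<forall>\<^sub>F k in sequentially. (\<integral>z. norm (fst z - s k (fst z)) ^ 2 \<partial>\<gamma>) < e / 2"
    by (rule order_tendstoD) (use e in simp)
  then obtain k where k: "(\<integral>z. norm (fst z - s k (fst z)) ^ 2 \<partial>\<gamma>) < e / 2"
    using eventually_happens'[OF sequentially_bot] by blast
  \<comment> \<open>The label is the simple approximation of x itself, so the identity is the
    function of the label used in the loss estimate.\<close>
  define R where "R = range (s k)"
  define K where "K z = s k (fst z)" for z :: "(real \<times> real) \<times> (real \<times> real)"
  have rK: "range K = R" unfolding K_def R_def by (auto simp: image_iff) (metis fst_conv)
  have finR: "finite R" unfolding R_def by (rule s(2))
  have finK: "finite (range K)" using finR rK by simp
  have Km: "K \<in> measurable \<gamma> (count_space UNIV)" unfolding K_def by (rule measurable_compose[OF proj(1) s(1)])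
  define p where "p v = (\<integral>z. indicator {v} (K z) \<partial>\<gamma> :: real)" for v
  define m where "m c v = (\<integral>z. indicator {v} (K z) * c (snd z) \<partial>\<gamma>)" for c :: "real \<times> real \<Rightarrow> real" and v
  define V where "V = (\<Sum>v\<in>R. m fst v * m snd v / p v)"
  \<comment> \<open>The cell is an event determined by x, so the martingale condition replaces x by
    y in the numerator. This makes the value V expressible through y and the label, the only data
    that can be imitated.\<close>
  have mean: "label_mean \<gamma> K (\<lambda>z. fst (fst z)) v = m fst v / p v" "label_mean \<gamma> K (\<lambda>z. snd (fst z)) v = m snd v / p v" for v
  proof -
    have "s k -` {v} \<in> sets borel" using measurable_sets[OF s(1)[of k], of "{v}"] by simp
    moreover have "indicator {v} (K z) = (indicator (s k -` {v}) (fst z) :: real)" for z by (simp add: K_def indicator_def)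
    ultimately show "label_mean \<gamma> K (\<lambda>z. fst (fst z)) v = m fst v / p v" "label_mean \<gamma> K (\<lambda>z. snd (fst z)) v = m snd v / p v"
      using b by (auto simp: label_mean_def m_def p_def barycentric_def)
  qed
  have product: "(\<integral>\<omega>. f (N \<omega>) / q (N \<omega>) * (g (N \<omega>) / q (N \<omega>)) \<partial>Q) = (\<Sum>v\<in>R. f v * g v / q v)"
    if Q: "prob_space Q" and N: "N \<in> measurable Q (count_space UNIV)" "range N \<subseteq> R" and q: "\<And>v. v \<in> R \<Longrightarrow> q v = (\<integral>\<omega>. indicator {v} (N \<omega>) \<partial>Q :: real)"
    for Q :: "'q measure" and N and f g q :: "real \<times> real \<Rightarrow> real"
  proof -
    interpret Q: prob_space Q by fact
    have "(\<integral>\<omega>. (f (N \<omega>) / q (N \<omega>) * (g (N \<omega>) / q (N \<omega>))) * 1 \<partial>Q) = (\<Sum>v\<in>R. (f v / q v * (g v / q v)) * (\<integral>\<omega>. indicator {v} (N \<omega>) * 1 \<partial>Q))"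
      by (rule integral_finite_label(2)[where h="\<lambda>v. f v / q v * (g v / q v)", OF N(1) finR N(2)]) simp
    also have "\<dots> = (\<Sum>v\<in>R. f v * g v / q v)" using q by (intro sum.cong) auto
    finally show ?thesis by simp
  qed
  have "(\<integral>z. label_mean \<gamma> K (\<lambda>z. fst (fst z)) (K z) * label_mean \<gamma> K (\<lambda>z. snd (fst z)) (K z) \<partial>\<gamma>) = V"
    unfolding mean V_def by (rule product[OF P Km]) (auto simp: rK p_def)
  then have loss: "(\<integral>z. fst (fst z) * snd (fst z) \<partial>\<gamma>) \<le> V + e / 2"
    using label_mean_product_loss[OF P Km finK proj(1) sqx, of "\<lambda>v. v"] k by (simp add: K_def)
  \<comment> \<open>The level j at which y is discretised is separate from the fixed level k of the
    label: refining j improves the barycentres while the label values and their masses stay the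
    same.\<close>
  have "\<exists>L. L \<in> measurable borel (count_space UNIV) \<and> range L \<subseteq> R \<and>
      (\<forall>v\<in>R. \<forall>b\<in>range (s j). measure \<nu> (s j -` {b} \<inter> L -` {v}) = measure \<gamma> (K -` {v} \<inter> (\<lambda>z. s j (snd z)) -` {b} \<inter> space \<gamma>))" for j
  proof (rule atomless_joint_law[OF fin\<nu> \<nu>(2) atomless P Km _ finK s(1,2), of "\<lambda>z. s j (snd z)" j])
    show "(\<lambda>z. s j (snd z)) \<in> measurable \<gamma> (count_space UNIV)" by (rule measurable_compose[OF proj(2) s(1)])
    show "measure \<nu> (s j -` {b}) = measure \<gamma> ((\<lambda>z. s j (snd z)) -` {b} \<inter> space \<gamma>)" for b
    proof -
      have "s j -` {b} \<in> sets borel" using measurable_sets[OF s(1)[of j], of "{b}"] by simp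
      then have "measure \<nu> (s j -` {b}) = measure \<gamma> (snd -` (s j -` {b}) \<inter> space \<gamma>)"
        unfolding law[symmetric] by (rule measure_distr[OF proj(2)])
      then show ?thesis by (simp add: vimage_comp comp_def)
    qed
  next
    fix L assume "L \<in> measurable borel (count_space UNIV)" "range L \<subseteq> range K"
      "\<And>v b. v \<in> range K \<Longrightarrow> b \<in> range (s j) \<Longrightarrow> measure \<nu> (s j -` {b} \<inter> L -` {v}) = measure \<gamma> (K -` {v} \<inter> (\<lambda>z. s j (snd z)) -` {b} \<inter> space \<gamma>)"
    then show ?thesis unfolding rK by blast
  qed
  then obtain L where L: "\<And>j. L j \<in> measurable borel (count_space UNIV)" "\<And>j. range (L j) \<subseteq> R"
    "\<And>j v b. v \<in> R \<Longrightarrow> b \<in> range (s j) \<Longrightarrow> measure \<nu> (s j -` {b} \<inter> L j -` {v}) = measure \<gamma> (K -` {v} \<inter> (\<lambda>z. s j (snd z)) -` {b} \<inter> space \<gamma>)"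
    by metis
  have Ln: "L j \<in> measurable \<nu> (count_space UNIV)" for j using L(1)[of j] \<nu>(2) by (simp cong: measurable_cong_sets)
  define n where "n j c v = (\<integral>y. indicator {v} (L j y) * c y \<partial>\<nu>)" for j and c :: "real \<times> real \<Rightarrow> real" and v
  have norm1: "integrable \<nu> (\<lambda>y. norm y ^ 1)"
    using finite_measure.square_integrable_imp_integrable[OF prob_space.axioms(1)[OF \<nu>(1)], of norm] sq\<nu> id by simp
  have \<delta>: "(\<lambda>j. \<integral>y. norm (y - s j y) \<partial>\<nu>) \<longlonglongrightarrow> 0" "integrable \<nu> (\<lambda>y. norm (y - s j y))" for j
    using simple_approximation_tendsto[OF id sb s(3,4) norm1] by simp_all
  have close: "\<bar>n j c v - m c v\<bar> \<le> 2 * (\<integral>y. norm (y - s j y) \<partial>\<nu>)" and q: "(\<integral>y. indicator {v} (L j y) \<partial>\<nu>) = p v"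
    if "v \<in> R" "c \<in> {fst, snd}" for j c v
  proof -
    have c: "c \<in> borel_measurable borel" "\<bar>c x - c y\<bar> \<le> norm (x - y)" "integrable \<nu> c" for x y :: "real \<times> real"
      using that(2) i\<nu> abs_component_le_norm[of "x - y"] by auto
    show "\<bar>n j c v - m c v\<bar> \<le> 2 * (\<integral>y. norm (y - s j y) \<partial>\<nu>)"
      unfolding n_def m_def
      by (rule label_integral_close(1)[OF \<nu> P proj(2) law s(1,2) L(1) Km L(3)[OF that(1)] c(1,2,3) \<delta>(2)])
    show "(\<integral>y. indicator {v} (L j y) \<partial>\<nu>) = p v"
      unfolding p_def
      by (rule label_integral_close(2)[OF \<nu> P proj(2) law s(1,2) L(1) Km L(3)[OF that(1)] c(1,2,3) \<delta>(2)])
  qed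
  have mass: "(\<integral>y. indicator {v} (L j y) \<partial>\<nu>) = p v" if "v \<in> R" for j v
    using q[OF that, of fst] by simp
  have nlim: "(\<lambda>j. n j c v) \<longlonglongrightarrow> m c v" if "v \<in> R" "c \<in> {fst, snd}" for c v
  proof (rule LIM_zero_cancel, rule Lim_null_comparison[OF always_eventually, OF allI])
    show "norm (n j c v - m c v) \<le> 2 * (\<integral>y. norm (y - s j y) \<partial>\<nu>)" for j using close[OF that] by simp
    show "(\<lambda>j. 2 * (\<integral>y. norm (y - s j y) \<partial>\<nu>)) \<longlonglongrightarrow> 0" using tendsto_mult_right_zero[OF \<delta>(1)] by simp
  qed
  \<comment> \<open>The masses are matched exactly, so the factor \<open>inverse (p v)\<close> is
    constant in j and the limit is valid for null cells too.\<close>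
  have "(\<lambda>j. \<Sum>v\<in>R. n j fst v * n j snd v * inverse (p v)) \<longlonglongrightarrow> (\<Sum>v\<in>R. m fst v * m snd v * inverse (p v))"
    by (intro tendsto_sum tendsto_mult nlim tendsto_const) auto
  then have "(\<lambda>j. \<Sum>v\<in>R. n j fst v * n j snd v / p v) \<longlonglongrightarrow> V" unfolding V_def by (simp add: divide_inverse)
  then have "\<forall>\<^sub>F j in sequentially. V - e / 2 < (\<Sum>v\<in>R. n j fst v * n j snd v / p v)"
    by (rule order_tendstoD) (use e in simp)
  then obtain j where j: "V - e / 2 < (\<Sum>v\<in>R. n j fst v * n j snd v / p v)"
    using eventually_happens'[OF sequentially_bot] by blast
  define T where "T y = (label_mean \<nu> (L j) fst (L j y), label_mean \<nu> (L j) snd (L j y))" for y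
  have "T \<in> borel_measurable borel"
    unfolding T_def by (rule measurable_compose[OF L(1)]) simp
  moreover have "barycentric \<nu> T (\<lambda>y. y)"
    unfolding T_def using barycentric_label_mean[OF \<nu>(1) Ln[of j] finite_subset[OF L(2) finR] id sq\<nu>] by simp
  moreover have "(\<integral>y. fst (T y) * snd (T y) \<partial>\<nu>) = (\<Sum>v\<in>R. n j fst v * n j snd v / p v)"
  proof -
    have "(\<integral>y. fst (T y) * snd (T y) \<partial>\<nu>) = (\<integral>y. n j fst (L j y) / p (L j y) * (n j snd (L j y) / p (L j y)) \<partial>\<nu>)"
    proof (rule Bochner_Integration.integral_cong)
      fix y
      have "L j y \<in> R" using L(2) by blast
      then show "fst (T y) * snd (T y) = n j fst (L j y) / p (L j y) * (n j snd (L j y) / p (L j y))"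
        by (simp add: T_def label_mean_def n_def mass)
    qed simp
    also have "\<dots> = (\<Sum>v\<in>R. n j fst v * n j snd v / p v)"
      by (rule product[OF \<nu>(1) Ln L(2)]) (simp add: mass)
    finally show ?thesis .
  qed
  ultimately show ?thesis using that[of T] loss j by simp
qed

section \<open>Attainment of the minimum and equality of the two infima\<close>

theorem theorem3:
  fixes M :: "'a measure" and Y :: "'a \<Rightarrow> real \<times> real"
  assumes "prob_space M"
    and "Y \<in> borel_measurable M"
    and "integrable M (\<lambda>\<omega>. (norm (Y \<omega>))\<^sup>2)"
    and "\<And>y. emeasure (distr M borel Y) {y} = 0"
  shows "(\<exists>\<gamma>\<in>Gamma (distr M borel Y). \<forall>\<gamma>'\<in>Gamma (distr M borel Y).
            (\<integral>z. cost (fst z) (snd z) \<partial>\<gamma>) \<le> (\<integral>z. cost (fst z) (snd z) \<partial>\<gamma>'))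
      \<and> (INF \<gamma>\<in>Gamma (distr M borel Y). \<integral>z. cost (fst z) (snd z) \<partial>\<gamma>)
        = (INF X\<in>Xset M Y. \<integral>\<omega>. cost (X \<omega>) (Y \<omega>) \<partial>M)"
proof -
  note M = assms(1) and Y [measurable] = assms(2) and sq = assms(3)
  define \<nu> where "\<nu> = distr M borel Y"
  define J where "J \<gamma> = (\<integral>z. cost (fst z) (snd z) \<partial>\<gamma>)" for \<gamma> :: "((real \<times> real) \<times> (real \<times> real)) measure"
  define I where "I X = (\<integral>\<omega>. cost (X \<omega>) (Y \<omega>) \<partial>M)" for X
  interpret prob_space M by fact
  \<comment> \<open>Every admissible X is a special plan of the same cost, which gives one of the
    two inequalities.\<close>
  have plan: "distr M borel (\<lambda>\<omega>. (X \<omega>, Y \<omega>)) \<in> Gamma \<nu>" "J (distr M borel (\<lambda>\<omega>. (X \<omega>, Y \<omega>))) = I X" if "X \<in> Xset M Y" for X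
  proof -
    have b: "barycentric M X Y" using that Xset_iff_barycentric[OF M Y sq] by simp
    then have X: "X \<in> borel_measurable M" by (simp add: barycentric_def)
    show "distr M borel (\<lambda>\<omega>. (X \<omega>, Y \<omega>)) \<in> Gamma \<nu>" using b distr_Pair_in_Gamma_iff[OF M X Y] by (simp add: \<nu>_def)
    show "J (distr M borel (\<lambda>\<omega>. (X \<omega>, Y \<omega>))) = I X" unfolding J_def I_def by (rule integral_cost_distr_Pair[OF X Y])
  qed
  have map: "(\<lambda>\<omega>. T (Y \<omega>)) \<in> Xset M Y" "I (\<lambda>\<omega>. T (Y \<omega>)) = (\<integral>y. fst y * snd y \<partial>\<nu>) - (\<integral>y. fst (T y) * snd (T y) \<partial>\<nu>)"
    if T [measurable]: "T \<in> borel_measurable borel" and b: "barycentric \<nu> T (\<lambda>y. y)" for T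
  proof -
    have b': "barycentric M (\<lambda>\<omega>. T (Y \<omega>)) Y"
      using b unfolding \<nu>_def by (subst (asm) barycentric_distr_iff) auto
    have "Y \<in> measurable (vimage_algebra (space M) Y borel) borel" by (rule measurable_vimage_algebra1) auto
    then have "(\<lambda>\<omega>. T (Y \<omega>)) \<in> measurable (vimage_algebra (space M) Y borel) borel" by measurable
    then show "(\<lambda>\<omega>. T (Y \<omega>)) \<in> Xset M Y" using b' Xset_iff_barycentric[OF M Y sq] by simp
    show "I (\<lambda>\<omega>. T (Y \<omega>)) = (\<integral>y. fst y * snd y \<partial>\<nu>) - (\<integral>y. fst (T y) * snd (T y) \<partial>\<nu>)"
      unfolding I_def barycentric_integral_cost[OF M b'] \<nu>_def by (simp add: integral_distr)
  qed
  have Jval: "J \<gamma> = (\<integral>y. fst y * snd y \<partial>\<nu>) - (\<integral>z. fst (fst z) * snd (fst z) \<partial>\<gamma>)" if "\<gamma> \<in> Gamma \<nu>" for \<gamma>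
  proof -
    have g: "prob_space \<gamma>" "sets \<gamma> = sets borel" "distr \<gamma> borel snd = \<nu>" "barycentric \<gamma> fst snd"
      using that Gamma_iff_barycentric by auto
    show ?thesis
      unfolding J_def barycentric_integral_cost[OF g(1,4)] g(3)[symmetric]
      using borel_measurable_proj[OF g(2)] by (simp add: integral_distr)
  qed
  have approx: "\<exists>X\<in>Xset M Y. I X \<le> J \<gamma> + e" if G: "\<gamma> \<in> Gamma \<nu>" and e: "0 < e" for \<gamma> e
  proof -
    obtain T where T: "T \<in> borel_measurable borel" "barycentric \<nu> T (\<lambda>y. y)"
      "(\<integral>z. fst (fst z) * snd (fst z) \<partial>\<gamma>) \<le> (\<integral>y. fst (T y) * snd (T y) \<partial>\<nu>) + e"
      by (rule Gamma_approximation_by_maps[OF assms(4)[folded \<nu>_def] G e]) (rule that; assumption)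
    then show ?thesis using map[OF T(1,2)] Jval[OF G] by (intro bexI[of _ "\<lambda>\<omega>. T (Y \<omega>)"]) auto
  qed
  \<comment> \<open>A real infimum carries information only for a nonempty family that is bounded
    below. The one-point label supplies a member: the constant mean of Y.\<close>
  have ne: "Xset M Y \<noteq> {}"
  proof -
    have [measurable]: "(\<lambda>\<omega>. ()) \<in> measurable M (count_space UNIV)" by simp
    have b: "barycentric M (\<lambda>\<omega>. (label_mean M (\<lambda>_. ()) (\<lambda>\<omega>. fst (Y \<omega>)) (), label_mean M (\<lambda>_. ()) (\<lambda>\<omega>. snd (Y \<omega>)) ())) Y"
      using barycentric_label_mean[OF M _ _ Y sq, of "\<lambda>_. ()"] by simp
    then show ?thesis using Xset_iff_barycentric[OF M Y sq] by fastforce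
  qed
  then have ne': "Gamma \<nu> \<noteq> {}" using plan by blast
  have low: "bdd_below (J ` Gamma \<nu>)"
  proof (rule bdd_belowI2)
    fix \<gamma> assume G: "\<gamma> \<in> Gamma \<nu>"
    have g: "prob_space \<gamma>" "sets \<gamma> = sets borel" "distr \<gamma> borel snd = \<nu>" and b: "barycentric \<gamma> fst snd"
      using G Gamma_iff_barycentric by auto
    note proj [measurable] = borel_measurable_proj[OF g(2)]
    have s: "integrable \<gamma> (\<lambda>z. (fst (fst z))\<^sup>2)" "integrable \<gamma> (\<lambda>z. (snd (fst z))\<^sup>2)"
      using b square_integrable_components[OF g(1) proj(1)] by (auto simp: barycentric_def)
    \<comment> \<open>Together with contraction this bounds E[x1 x2] by second moments of \<nu>,
      hence the cost from below by a constant common to all plans.\<close>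
    have "(\<integral>z. fst (fst z) * snd (fst z) \<partial>\<gamma>) \<le> (\<integral>z. (fst (fst z))\<^sup>2 + (snd (fst z))\<^sup>2 \<partial>\<gamma>)"
    proof (rule integral_mono)
      show "integrable \<gamma> (\<lambda>z. fst (fst z) * snd (fst z))" by (intro square_integrable_mult s) measurable
      have "a * b \<le> a\<^sup>2 + b\<^sup>2" for a b :: real
        using sum_squares_bound[of a b] zero_le_power2[of a] zero_le_power2[of b] zero_le_power2[of "a + b"] by (simp add: power2_sum)
      then show "fst (fst z) * snd (fst z) \<le> (fst (fst z))\<^sup>2 + (snd (fst z))\<^sup>2" for z :: "(real \<times> real) \<times> (real \<times> real)" .
    qed (use s in auto)
    also have "\<dots> \<le> (\<integral>z. (fst (snd z))\<^sup>2 \<partial>\<gamma>) + (\<integral>z. (snd (snd z))\<^sup>2 \<partial>\<gamma>)"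
      using s barycentric_second_moments_le[OF g(1) b] by simp
    also have "\<dots> = (\<integral>y. (fst y)\<^sup>2 \<partial>\<nu>) + (\<integral>y. (snd y)\<^sup>2 \<partial>\<nu>)"
      unfolding g(3)[symmetric] by (simp add: integral_distr)
    finally show "(\<integral>y. fst y * snd y \<partial>\<nu>) - ((\<integral>y. (fst y)\<^sup>2 \<partial>\<nu>) + (\<integral>y. (snd y)\<^sup>2 \<partial>\<nu>)) \<le> J \<gamma>"
      using Jval[OF G] by simp
  qed
  have I_low: "Inf (J ` Gamma \<nu>) \<le> I X" if "X \<in> Xset M Y" for X
    using cINF_lower[OF low plan(1)[OF that]] plan(2)[OF that] by simp
  have "Inf (J ` Gamma \<nu>) = Inf (I ` Xset M Y)"
  proof (rule antisym)
    show "Inf (J ` Gamma \<nu>) \<le> Inf (I ` Xset M Y)" by (rule cINF_greatest[OF ne I_low])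
    show "Inf (I ` Xset M Y) \<le> Inf (J ` Gamma \<nu>)"
    proof (rule cINF_greatest[OF ne'], rule field_le_epsilon)
      fix \<gamma> and e :: real assume "\<gamma> \<in> Gamma \<nu>" "0 < e"
      then obtain X where X: "X \<in> Xset M Y" "I X \<le> J \<gamma> + e" using approx by blast
      have "Inf (I ` Xset M Y) \<le> I X" by (rule cINF_lower[OF bdd_belowI2[OF I_low] X(1)])
      then show "Inf (I ` Xset M Y) \<le> J \<gamma> + e" using X(2) by simp
    qed
  qed
  moreover have "\<exists>\<gamma>\<in>Gamma \<nu>. \<forall>\<gamma>'\<in>Gamma \<nu>. J \<gamma> \<le> J \<gamma>'"
  proof -
    \<comment> \<open>A minimising sequence; along the subsequence given by compactness the costs
      converge to that of a plan, which therefore attains the infimum.\<close>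
    have "\<exists>\<gamma>\<in>Gamma \<nu>. J \<gamma> < Inf (J ` Gamma \<nu>) + 1 / real (Suc n)" for n
      using cInf_lessD[of "J ` Gamma \<nu>" "Inf (J ` Gamma \<nu>) + 1 / real (Suc n)"] ne' by auto
    then obtain \<gamma> where G: "\<And>n. \<gamma> n \<in> Gamma \<nu>" and Jn: "\<And>n. J (\<gamma> n) < Inf (J ` Gamma \<nu>) + 1 / real (Suc n)" by metis
    obtain \<gamma>' r where g: "\<gamma>' \<in> Gamma \<nu>" "strict_mono (r :: nat \<Rightarrow> nat)" "(\<lambda>n. J (\<gamma> (r n))) \<longlonglongrightarrow> J \<gamma>'"
      by (rule Gamma_sequentially_compact[where \<gamma>=\<gamma> and \<nu>=\<nu>, OF G, folded J_def]) (rule that; assumption)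
    have "(\<lambda>n. Inf (J ` Gamma \<nu>) + 1 / real (Suc (r n))) \<longlonglongrightarrow> Inf (J ` Gamma \<nu>) + 0"
      by (intro tendsto_add tendsto_const LIMSEQ_subseq_LIMSEQ[OF lim_1_over_n[THEN LIMSEQ_Suc] g(2), unfolded comp_def])
    then have "J \<gamma>' \<le> Inf (J ` Gamma \<nu>)"
      using tendsto_le[OF sequentially_bot _ g(3)] Jn by (simp add: less_imp_le)
    then show ?thesis using cINF_lower[OF low] g(1) by (intro bexI[of _ \<gamma>']) (auto intro: order_trans)
  qed
  ultimately show ?thesis unfolding J_def I_def \<nu>_def by blast
qed

end
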